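(* Suppose $k\ge 4$ is even. Let $L$ be an irredundant linear system with girth $s(L)=k-1$ that has an irredundant $2\times k$ subsystem. Then there exists $p_L$ such that $L$ is uncommon over $\mathbb{F}_p$ for all primes $p\ge p_L$.
   Context: An $m\times K$ linear system $L$ is a collection of $m$ homogeneous linear equations in $K$ variables $x_1,\dots,x_K$ with integer coefficients, identified with its coefficient matrix $L\in\mathbb{Z}^{m\times K}$ (equations $L\mathbf{x}=0$). Row spans are taken over $\mathbb{Q}$. $L$ is irredundant if: (1) its rows are linearly independent; (2) no column of $L$ is zero; (3) the row span of $L$ contains no vector having one entry $1$, one entry $-1$ and all other entries $0$. The girth $s(L)$ is the minimum size of the support of a nonzero vector in the row span of $L$. An $m'\times k'$ linear system $L'$ on a subset $x_{i_1},\dots,x_{i_{k'}}$ of the variables is a subsystem of $L$ if $L\mathbf{x}=0$ implies $L'\mathbf{x}'=0$, where $\mathbf{x}'=(x_{i_1},\dots,x_{i_{k'}})$ (equivalently, each row of $L'$, extended by zeros to all $K$ variables, lies in the row span of $L$). For a prime $p$, $n\in\mathbb{N}$ and $f:\mathbb{F}_p^n\to\mathbb{R}$, let $t_L(f)=\mathbb{E}_{\mathbf{x}\in(\mathbb{F}_p^n)^K:\,L\mathbf{x}=0}\,f(x_1)\cdots f(x_K)$ (average over all solutions). An irredundant $m\times K$ system $L$ is common over $\mathbb{F}_p$ if for all $n\in\mathbb{N}$ and all $f:\mathbb{F}_p^n\to[0,1]$ one has $t_L(f)+t_L(1-f)\ge 2^{1-K}$; otherwise $L$ is uncommon over $\mathbb{F}_p$.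 *)

theory Defs
  imports
    "HOL-Library.FuncSet"
    "HOL-Number_Theory.Cong"
    "HOL-Computational_Algebra.Primes"
    "Jordan_Normal_Form.VS_Connect"
begin

text \<open>
  A linear system of m equations in K variables is an integer matrix \<open>L\<close> in
  \<open>carrier_mat m K\<close>. Indices start at 0, so the variables are numbered 0, ..., K - 1.
\<close>

abbreviation rat_mat :: "int mat \<Rightarrow> rat mat" where
  "rat_mat L \<equiv> map_mat rat_of_int L"

definition row_span :: "int mat \<Rightarrow> rat vec set" where
  "row_span L = vec_space.row_space (dim_col L) (rat_mat L)"

text \<open>
  \<open>module.lin_dep\<close> is a predicate on sets of vectors; \<open>distinct\<close> turns it into linear
  independence of the family of rows.
\<close>

definition rows_independent :: "int mat \<Rightarrow> bool" where
  "rows_independent L \<longleftrightarrow>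
     distinct (rows (rat_mat L)) \<and>
     \<not> module.lin_dep class_ring (module_vec TYPE(rat) (dim_col L)) (set (rows (rat_mat L)))"

definition irredundant :: "int mat \<Rightarrow> bool" where
  "irredundant L \<longleftrightarrow>
     rows_independent L \<and>
     (\<forall>j<dim_col L. col L j \<noteq> 0\<^sub>v (dim_row L)) \<and>
     \<not> (\<exists>i<dim_col L. \<exists>j<dim_col L. i \<noteq> j \<and>
          unit_vec (dim_col L) i - unit_vec (dim_col L) j \<in> row_span L)"

definition support :: "rat vec \<Rightarrow> nat set" where
  "support v = {j. j < dim_vec v \<and> v $ j \<noteq> 0}"

text \<open>
  The infimum is a minimum whenever the row span is nonzero; for zero row span it takes the
  junk value 0, which is never the support size of a nonzero vector.
\<close>

definition girth :: "int mat \<Rightarrow> nat" where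
  "girth L = (INF v \<in> row_span L - {0\<^sub>v (dim_col L)}. card (support v))"

text \<open>
  \<open>L'\<close> is a system on the variables numbered \<open>\<iota> 0, ..., \<iota> (k' - 1)\<close> of \<open>L\<close>, where \<open>k'\<close> is the
  number of columns of \<open>L'\<close>. Solutions range over the rationals.
\<close>

definition subsystem :: "int mat \<Rightarrow> int mat \<Rightarrow> bool" where
  "subsystem L' L \<longleftrightarrow>
     (\<exists>\<iota>. inj_on \<iota> {..<dim_col L'} \<and> \<iota> ` {..<dim_col L'} \<subseteq> {..<dim_col L} \<and>
       (\<forall>x \<in> carrier_vec (dim_col L).
          rat_mat L *\<^sub>v x = 0\<^sub>v (dim_row L) \<longrightarrow>
          rat_mat L' *\<^sub>v vec (dim_col L') (\<lambda>j. x $ \<iota> j) = 0\<^sub>v (dim_row L')))"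

text \<open>
  There is no type of integers modulo a variable \<open>p\<close>, so the n-dimensional space over the field
  with \<open>p\<close> elements is represented by vectors of least nonnegative residues, and equations over
  that field by congruences.
\<close>

definition Fp_space :: "nat \<Rightarrow> nat \<Rightarrow> int vec set" where
  "Fp_space p n = {v \<in> carrier_vec n. \<forall>j<n. v $ j \<in> {0..<int p}}"

definition solutions :: "nat \<Rightarrow> nat \<Rightarrow> int mat \<Rightarrow> (nat \<Rightarrow> int vec) set" where
  "solutions p n L =
     {x \<in> {..<dim_col L} \<rightarrow>\<^sub>E Fp_space p n.
        \<forall>i<dim_row L. \<forall>j<n. [(\<Sum>c<dim_col L. L $$ (i, c) * x c $ j) = 0] (mod int p)}"

definition t_density :: "nat \<Rightarrow> nat \<Rightarrow> int mat \<Rightarrow> (int vec \<Rightarrow> real) \<Rightarrow> real" where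
  "t_density p n L f =
     (\<Sum>x\<in>solutions p n L. \<Prod>c<dim_col L. f (x c)) / real (card (solutions p n L))"

definition common_over :: "nat \<Rightarrow> int mat \<Rightarrow> bool" where
  "common_over p L \<longleftrightarrow>
     (\<forall>n. \<forall>f :: int vec \<Rightarrow> real. (\<forall>v\<in>Fp_space p n. f v \<in> {0..1}) \<longrightarrow>
        t_density p n L f + t_density p n L (\<lambda>v. 1 - f v) \<ge> 2 powi (1 - int (dim_col L)))"

abbreviation uncommon_over :: "nat \<Rightarrow> int mat \<Rightarrow> bool" where
  "uncommon_over p L \<equiv> \<not> common_over p L"

end

theory Submission
  imports Defs
begin

text \<open>
  For \<open>f = 1/2 + \<epsilon> g\<close> with \<open>g\<close> even and of mean zero, Fourier expansion of \<open>t_L(f) + t_L(1 - f)\<close> gives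
  \<open>2^(1-K)\<close> plus a sum over the nonzero tuples \<open>V\<close> of frequencies that lie in the row space of \<open>L\<close>
  coordinatewise and have even support. Since the girth \<open>k - 1\<close> is odd, the leading part has
  support \<open>k\<close>, so it suffices to make that part negative. The frequencies of \<open>g\<close> are taken from a
  finite set of integer vectors independent of \<open>p\<close>; for large \<open>p\<close> lying in the row space modulo \<open>p\<close>
  is the same as lying in it over the rationals.

  Let \<open>a\<close>, \<open>b\<close> be the rows of the subsystem. The frequencies are \<open>\<plusminus> (a_c, b_c, a_c \<xi> + b_c \<eta>)\<close>, where the
  pair \<open>(\<xi>, \<eta>)\<close> of vectors in \<open>{0..M-1}^7\<close> has a fixed popular Gram matrix; the coefficient is \<open>-1\<close>
  for one fixed \<open>c\<close> and \<open>1\<close> for the others. In a tuple of support \<open>k\<close>, either every \<open>c\<close> occurs exactly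
  once, and the tuple contributes \<open>-1\<close>, or only one \<open>c\<close> occurs. In the latter case, as in Behrend's
  construction, the tuple consists of collinear points on a sphere (up to sign), hence of copies
  of one \<open>\<plusminus> u\<close>. There are \<open>O(M^7)\<close> tuples of the second kind, but at least a constant times \<open>M^8\<close> of
  the first kind.
\<close>

section \<open>Integer consequences of a linear system\<close>

text \<open>Membership of \<open>v\<close> in the rational row span of \<open>L\<close>, expressed
  by duality through integer solutions. In this form it compares directly with divisibility on
  solutions modulo \<open>p\<close>.\<close>

definition implied_equation :: "int mat \<Rightarrow> (nat \<Rightarrow> int) \<Rightarrow> bool" where
  "implied_equation L v \<longleftrightarrow>
     (\<forall>x. (\<forall>i<dim_row L. (\<Sum>c<dim_col L. L $$ (i, c) * x c) = 0) \<longrightarrow>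
        (\<Sum>c<dim_col L. v c * x c) = 0)"

lemma implied_equation_lincomb:
  assumes "implied_equation L v" "implied_equation L w"
  shows "implied_equation L (\<lambda>c. a * v c + b * w c)"
  using assms
  by (auto simp: implied_equation_def algebra_simps sum.distrib simp flip: sum_distrib_left)

text \<open>Induction on the number of equations. If the last one follows from the others, it is
  dropped. Otherwise some \<open>z\<close> in the kernel of the others has a nonzero value under it,
  and a multiple of \<open>w\<close>, corrected by a multiple of the last row, vanishes on that
  larger kernel. The factor \<open>d\<close> avoids division.\<close>

lemma int_combination_if_vanishes_on_kernel:
  fixes l :: "nat \<Rightarrow> nat \<Rightarrow> int" and w :: "nat \<Rightarrow> int"
  assumes "\<And>x. (\<forall>i<m. (\<Sum>c<K. l i c * x c) = 0) \<Longrightarrow> (\<Sum>c<K. w c * x c) = 0"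
  shows "\<exists>d lam. d \<noteq> 0 \<and> (\<forall>c<K. d * w c = (\<Sum>i<m. lam i * l i c))"
  using assms
proof (induction m arbitrary: w)
  case 0
  have "w c = 0" if "c < K" for c
    using 0[of "\<lambda>j. if j = c then 1 else 0"] that by (simp add: if_distrib cong: if_cong)
  then show ?case by (intro exI[of _ 1]) auto
next
  case (Suc m)
  show ?case
  proof (cases "\<exists>x. (\<forall>i<m. (\<Sum>c<K. l i c * x c) = 0) \<and> (\<Sum>c<K. l m c * x c) \<noteq> 0")
    case False
    have "\<exists>d lam. d \<noteq> 0 \<and> (\<forall>c<K. d * w c = (\<Sum>i<m. lam i * l i c))"
      by (rule Suc.IH) (use False Suc.prems less_Suc_eq in metis)
    then obtain d lam where "d \<noteq> 0" "\<forall>c<K. d * w c = (\<Sum>i<m. lam i * l i c)" by blast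
    then show ?thesis
      by (intro exI[of _ d] exI[of _ "lam(m := 0)"]) auto
  next
    case True
    then obtain z where z: "\<forall>i<m. (\<Sum>c<K. l i c * z c) = 0" and nz: "(\<Sum>c<K. l m c * z c) \<noteq> 0"
      by blast
    define \<alpha> where "\<alpha> = (\<Sum>c<K. l m c * z c)"
    define \<beta> where "\<beta> = (\<Sum>c<K. w c * z c)"
    have "\<exists>d lam. d \<noteq> 0 \<and> (\<forall>c<K. d * (\<alpha> * w c - \<beta> * l m c) = (\<Sum>i<m. lam i * l i c))"
    proof (rule Suc.IH)
      fix x assume x: "\<forall>i<m. (\<Sum>c<K. l i c * x c) = 0"
      define \<gamma> where "\<gamma> = (\<Sum>c<K. l m c * x c)"
      have lin: "(\<Sum>c<K. u c * (\<alpha> * x c - \<gamma> * z c)) =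
          \<alpha> * (\<Sum>c<K. u c * x c) - \<gamma> * (\<Sum>c<K. u c * z c)" for u
        by (simp add: algebra_simps sum_subtractf sum_distrib_left)
      \<comment> \<open>Correcting the multiple of \<open>x\<close> by a multiple of
        \<open>z\<close> lands in the kernel of all \<open>Suc m\<close> equations.\<close>
      have "(\<Sum>c<K. w c * (\<alpha> * x c - \<gamma> * z c)) = 0"
      proof (rule Suc.prems, intro allI impI)
        fix i assume "i < Suc m"
        then show "(\<Sum>c<K. l i c * (\<alpha> * x c - \<gamma> * z c)) = 0"
          using x z unfolding lin by (cases "i = m") (auto simp: \<alpha>_def \<gamma>_def)
      qed
      then have "\<alpha> * (\<Sum>c<K. w c * x c) = \<gamma> * \<beta>"
        unfolding lin \<beta>_def by simp
      then show "(\<Sum>c<K. (\<alpha> * w c - \<beta> * l m c) * x c) = 0"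
        unfolding \<gamma>_def by (simp add: algebra_simps sum_subtractf sum_distrib_left)
    qed
    then obtain d lam where d: "d \<noteq> 0"
      and lam: "\<forall>c<K. d * (\<alpha> * w c - \<beta> * l m c) = (\<Sum>i<m. lam i * l i c)" by blast
    have "(d * \<alpha>) * w c = (\<Sum>i<Suc m. (lam(m := d * \<beta>)) i * l i c)" if "c < K" for c
    proof -
      have "(\<Sum>i<m. (lam(m := d * \<beta>)) i * l i c) = (\<Sum>i<m. lam i * l i c)"
        by (intro sum.cong) auto
      with lam that show ?thesis by (simp add: algebra_simps)
    qed
    moreover have "d * \<alpha> \<noteq> 0" using d nz \<alpha>_def by simp
    ultimately show ?thesis by blast
  qed
qed

lemma implied_equation_combination:
  assumes "implied_equation L v"
  obtains d lam where "d \<noteq> 0"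
    "\<And>c. c < dim_col L \<Longrightarrow> d * v c = (\<Sum>i<dim_row L. lam i * L $$ (i, c))"
proof -
  have "\<exists>d lam. d \<noteq> 0 \<and> (\<forall>c<dim_col L. d * v c = (\<Sum>i<dim_row L. lam i * L $$ (i, c)))"
    by (rule int_combination_if_vanishes_on_kernel[where l = "\<lambda>i c. L $$ (i, c)"])
       (use assms in \<open>auto simp: implied_equation_def\<close>)
  then show ?thesis using that by blast
qed

lemma row_spanI:
  assumes "\<And>c. c < dim_col L \<Longrightarrow> w $ c = (\<Sum>i<dim_row L. of_int (lam i * L $$ (i, c)))"
    and "w \<in> carrier_vec (dim_col L)"
  shows "w \<in> row_span L"
proof -
  interpret vec_space "TYPE(rat)" "dim_col L" .
  have A: "rat_mat L \<in> carrier_mat (dim_row L) (dim_col L)" by auto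
  have "transpose_mat (rat_mat L) *\<^sub>v vec (dim_row L) (\<lambda>i. of_int (lam i)) = w"
    by (rule eq_vecI)
       (use assms in \<open>auto simp: scalar_prod_def atLeast0LessThan mult.commute intro!: sum.cong\<close>)
  then show ?thesis
    unfolding row_span_def row_space_eq[OF A] using assms(2) by auto
qed

text \<open>Only the multiple \<open>d * v\<close> is an integer combination of rows, but it has the
  same support as \<open>v\<close>.\<close>

lemma girth_le_implied_equation:
  assumes "implied_equation L v" "\<exists>c<dim_col L. v c \<noteq> 0"
  shows "girth L \<le> card {c. c < dim_col L \<and> v c \<noteq> 0}"
proof -
  obtain d lam where d: "d \<noteq> 0"
    and lam: "\<And>c. c < dim_col L \<Longrightarrow> d * v c = (\<Sum>i<dim_row L. lam i * L $$ (i, c))"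
    using implied_equation_combination[OF assms(1)] by blast
  define w :: "rat vec" where "w = vec (dim_col L) (\<lambda>c. of_int (d * v c))"
  have "w \<in> row_span L"
    by (rule row_spanI[where lam = lam]) (auto simp: w_def lam simp del: of_int_mult)
  moreover have "w \<noteq> 0\<^sub>v (dim_col L)"
    using assms(2) d by (auto simp: w_def vec_eq_iff)
  moreover have "support w = {c. c < dim_col L \<and> v c \<noteq> 0}"
    using d by (auto simp: support_def w_def)
  ultimately show ?thesis
    unfolding girth_def by (metis (no_types, lifting) Diff_iff cINF_lower bdd_below_bot singletonD)
qed

lemma implied_equation_eq_0:
  assumes "implied_equation L v"
    and "card {c. c < dim_col L \<and> v c \<noteq> 0} < girth L" and "c < dim_col L"
  shows "v c = 0"
  using girth_le_implied_equation[OF assms(1)] assms(2,3) by (meson leD)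

section \<open>The rows of the subsystem as implied equations\<close>

lemma rows_independent_2:
  assumes "L' \<in> carrier_mat 2 k" "rows_independent L'"
    and eq: "\<And>j. j < k \<Longrightarrow> s * L' $$ (0, j) + t * L' $$ (1, j) = 0"
  shows "s = 0 \<and> t = 0"
proof (rule ccontr)
  assume st: "\<not> (s = 0 \<and> t = 0)"
  interpret vec_space "TYPE(rat)" k .
  define A where "A = rat_mat L'"
  have A: "A \<in> carrier_mat 2 k" using assms(1) by (simp add: A_def)
  have r: "rows A = [row A 0, row A 1]"
    using A by (auto simp: rows_def numeral_2_eq_2)
  have ne: "row A 0 \<noteq> row A 1" and ind: "\<not> lin_dep (set (rows A))"
    using assms(1,2) r unfolding rows_independent_def A_def by auto
  have c: "row A 0 \<in> carrier_vec k" "row A 1 \<in> carrier_vec k" using A by auto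
  \<comment> \<open>One function on vectors can carry both coefficients because the two rows differ
    (\<open>ne\<close>).\<close>
  define f where "f = (\<lambda>v. if v = row A 0 then rat_of_int s else of_int t)"
  have "lincomb f {row A 0, row A 1} = f (row A 0) \<cdot>\<^sub>v row A 0 + f (row A 1) \<cdot>\<^sub>v row A 1"
    using lincomb_insert[of "{row A 1}" "row A 0" f] lincomb_insert[of "{}" "row A 1" f] c ne
    by (auto simp: lincomb_def finsum_insert finsum_empty)
  also have "\<dots> = 0\<^sub>v k"
  proof (rule eq_vecI)
    fix j assume "j < dim_vec (0\<^sub>v k :: rat vec)"
    then have j: "j < k" by simp
    have "rat_of_int (s * L' $$ (0, j) + t * L' $$ (1, j)) = 0" using eq[OF j] by simp
    then show "(f (row A 0) \<cdot>\<^sub>v row A 0 + f (row A 1) \<cdot>\<^sub>v row A 1) $ j = 0\<^sub>v k $ j"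
      using j A ne assms(1) by (auto simp: f_def A_def)
  qed (use A in auto)
  finally have "lincomb f {row A 0, row A 1} = 0\<^sub>v k" .
  moreover have "f (row A 0) \<noteq> 0 \<or> f (row A 1) \<noteq> 0" using st ne by (auto simp: f_def)
  ultimately have "lin_dep {row A 0, row A 1}"
    unfolding lin_dep_def by (intro exI[of _ "{row A 0, row A 1}"] exI[of _ f]) auto
  then show False using ind r by simp
qed

text \<open>The subsystem relation speaks of rational solutions, among which are the integer ones.
  Since \<open>v\<close> is row \<open>i\<close> of \<open>L'\<close> extended by zero, its value at
  \<open>x\<close> is that of the row at the selected variables.\<close>

lemma subsystem_implied_equation:
  assumes "inj_on \<iota> {..<dim_col L'}" "\<iota> ` {..<dim_col L'} \<subseteq> {..<dim_col L}"
    and sub: "\<And>x. x \<in> carrier_vec (dim_col L) \<Longrightarrow>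
          rat_mat L *\<^sub>v x = 0\<^sub>v (dim_row L) \<Longrightarrow>
          rat_mat L' *\<^sub>v vec (dim_col L') (\<lambda>j. x $ \<iota> j) = 0\<^sub>v (dim_row L')"
    and i: "i < dim_row L'"
    and v: "\<And>j. j < dim_col L' \<Longrightarrow> v (\<iota> j) = L' $$ (i, j)"
      "\<And>c. c \<notin> \<iota> ` {..<dim_col L'} \<Longrightarrow> v c = 0"
  shows "implied_equation L v"
  unfolding implied_equation_def
proof (intro allI impI)
  fix x :: "nat \<Rightarrow> int"
  assume x: "\<forall>i<dim_row L. (\<Sum>c<dim_col L. L $$ (i, c) * x c) = 0"
  define X :: "rat vec" where "X = vec (dim_col L) (\<lambda>c. of_int (x c))"
  have "(rat_mat L *\<^sub>v X) $ a = of_int (\<Sum>c<dim_col L. L $$ (a, c) * x c)" if "a < dim_row L" for a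
    using that by (auto simp: X_def scalar_prod_def atLeast0LessThan intro!: sum.cong)
  then have "rat_mat L *\<^sub>v X = 0\<^sub>v (dim_row L)"
    using x by (intro eq_vecI) auto
  then have "rat_mat L' *\<^sub>v vec (dim_col L') (\<lambda>j. X $ \<iota> j) = 0\<^sub>v (dim_row L')"
    by (intro sub) (auto simp: X_def)
  then have "(rat_mat L' *\<^sub>v vec (dim_col L') (\<lambda>j. X $ \<iota> j)) $ i = 0"
    using i by simp
  also have "(rat_mat L' *\<^sub>v vec (dim_col L') (\<lambda>j. X $ \<iota> j)) $ i =
      of_int (\<Sum>j<dim_col L'. L' $$ (i, j) * x (\<iota> j))"
    using i assms(2) by (auto simp: X_def scalar_prod_def atLeast0LessThan intro!: sum.cong)
  finally have "(\<Sum>j<dim_col L'. v (\<iota> j) * x (\<iota> j)) = 0"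
    using v by (simp flip: of_int_mult of_int_sum)
  also have "(\<Sum>j<dim_col L'. v (\<iota> j) * x (\<iota> j)) = (\<Sum>c\<in>\<iota> ` {..<dim_col L'}. v c * x c)"
    using assms(1) by (simp add: sum.reindex)
  also have "\<dots> = (\<Sum>c<dim_col L. v c * x c)"
    using assms(2) v by (intro sum.mono_neutral_left) auto
  finally show "(\<Sum>c<dim_col L. v c * x c) = 0" .
qed

section \<open>Frequencies from points on spheres\<close>

text \<open>Pigeonhole: there are M^14 pairs and at most (7 M^2 + 1)^3 Gram matrices, so some class
  has at least M^8 / 512 pairs, eventually more than any constant times M^7. Dimension 7 is the
  least D with 2 D - 6 > D. The factor (2 B M + 1)^7 counts the lattice points of a box that will
  contain the vectors a_c \<xi> + b_c \<eta>.\<close>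

lemma popular_gram_matrix:
  fixes C B :: nat
  obtains M :: nat and q1 q2 q3 :: int where
    "C * (2 * B * M + 1) ^ 7 < card {(\<xi>, \<eta>) \<in> ({..<7::nat} \<rightarrow>\<^sub>E {0..<int M}) \<times> ({..<7} \<rightarrow>\<^sub>E {0..<int M}).
       (\<Sum>j<7. (\<xi> j)\<^sup>2) = q1 \<and> (\<Sum>j<7. (\<eta> j)\<^sup>2) = q2 \<and> (\<Sum>j<7. \<xi> j * \<eta> j) = q3}"
proof -
  \<comment> \<open>Just large enough that M^8 / 512 exceeds C ((2 B + 1) M)^7.\<close>
  define M where "M = 512 * (C * (2 * B + 1) ^ 7) + 1"
  define X where "X = ({..<7::nat} \<rightarrow>\<^sub>E {0..<int M})"
  define Y where "Y = {0..7 * (int M)\<^sup>2}"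
  define f :: "(nat \<Rightarrow> int) \<times> (nat \<Rightarrow> int) \<Rightarrow> int \<times> int \<times> int" where
    "f = (\<lambda>(\<xi>, \<eta>). (\<Sum>j<7. (\<xi> j)\<^sup>2, \<Sum>j<7. (\<eta> j)\<^sup>2, \<Sum>j<7. \<xi> j * \<eta> j))"
  have M: "M \<ge> 1" by (simp add: M_def)
  have cardX: "card X = M ^ 7" and finX: "finite X"
    by (auto simp: X_def card_PiE intro!: finite_PiE)
  have cardY: "card (Y \<times> Y \<times> Y) = (7 * M\<^sup>2 + 1) ^ 3"
  proof -
    have "card Y = nat (7 * (int M)\<^sup>2 + 1)" by (simp add: Y_def)
    also have "7 * (int M)\<^sup>2 + 1 = int (7 * M\<^sup>2 + 1)" by simp
    finally have "card Y = 7 * M\<^sup>2 + 1" by (simp only: nat_int)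
    then show ?thesis by (simp only: card_cartesian_product power3_eq_cube mult.assoc)
  qed
  have dot: "(\<Sum>j<7. \<xi> j * \<eta> j) \<in> Y" if "\<xi> \<in> X" "\<eta> \<in> X" for \<xi> \<eta>
  proof -
    have x: "\<xi> j \<in> {0..<int M}" "\<eta> j \<in> {0..<int M}" if "j < 7" for j
      using \<open>\<xi> \<in> X\<close> \<open>\<eta> \<in> X\<close> that unfolding X_def by blast+
    have "(\<Sum>j<7. \<xi> j * \<eta> j) \<le> (\<Sum>j<7::nat. int M * int M)"
      using x by (intro sum_mono mult_mono) (auto simp: less_imp_le)
    moreover have "(\<Sum>j<7. \<xi> j * \<eta> j) \<ge> 0"
      using x by (intro sum_nonneg mult_nonneg_nonneg) auto
    ultimately show ?thesis by (simp add: Y_def power2_eq_square)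
  qed
  have arith: "(8 * M\<^sup>2) ^ 3 * (C * (E * M) ^ 7) = (512 * (C * E ^ 7)) * M ^ 13" for E
  proof -
    have "M ^ 13 = M ^ 6 * M ^ 7" by (simp flip: power_add)
    then show ?thesis by (simp add: power_mult_distrib flip: power_mult)
  qed
  have f: "f \<in> X \<times> X \<rightarrow> Y \<times> Y \<times> Y"
    using dot by (auto simp: f_def power2_eq_square)
  have "\<exists>q\<in>Y \<times> Y \<times> Y. C * (2 * B * M + 1) ^ 7 < card {x \<in> X \<times> X. f x = q}"
  proof (rule ccontr)
    assume "\<not> ?thesis"
    then have le: "card {x \<in> X \<times> X. f x = q} \<le> C * (2 * B * M + 1) ^ 7" if "q \<in> Y \<times> Y \<times> Y" for q
      using that by (meson not_less)
    have "card (X \<times> X) = (\<Sum>q\<in>Y \<times> Y \<times> Y. card {x \<in> X \<times> X. f x = q})"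
      using sum.group[of "X \<times> X" "Y \<times> Y \<times> Y" f "\<lambda>_. 1::nat"] f finX
      by (simp add: Y_def image_subset_iff_funcset del: mem_Sigma_iff)
    also have "\<dots> \<le> (\<Sum>q\<in>Y \<times> Y \<times> Y. C * (2 * B * M + 1) ^ 7)"
      by (intro sum_mono le)
    also have "\<dots> = (7 * M\<^sup>2 + 1) ^ 3 * (C * (2 * B * M + 1) ^ 7)"
      by (simp only: sum_constant cardY of_nat_id)
    \<comment> \<open>\<open>M \<ge> 1\<close> absorbs both additive ones: 7 M^2 + 1 \<le> 8 M^2 and
      2 B M + 1 \<le> (2 B + 1) M.\<close>
    also have "\<dots> \<le> (8 * M\<^sup>2) ^ 3 * (C * ((2 * B + 1) * M) ^ 7)"
      using M by (intro mult_mono power_mono) (auto simp: algebra_simps)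
    also have "\<dots> = (512 * (C * (2 * B + 1) ^ 7)) * M ^ 13"
      by (rule arith)
    also have "\<dots> < M * M ^ 13"
      using M by (intro mult_strict_right_mono) (auto simp: M_def)
    also have "\<dots> = card (X \<times> X)"
      by (simp add: card_cartesian_product cardX flip: power_add power_Suc)
    finally show False by simp
  qed
  then obtain q1 q2 q3 where "C * (2 * B * M + 1) ^ 7 < card {x \<in> X \<times> X. f x = (q1, q2, q3)}"
    by auto
  also have "{x \<in> X \<times> X. f x = (q1, q2, q3)} = {(\<xi>, \<eta>) \<in> X \<times> X.
       (\<Sum>j<7. (\<xi> j)\<^sup>2) = q1 \<and> (\<Sum>j<7. (\<eta> j)\<^sup>2) = q2 \<and> (\<Sum>j<7. \<xi> j * \<eta> j) = q3}"
    by (auto simp: f_def)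
  finally show ?thesis using that unfolding X_def by blast
qed

text \<open>Abstracts the integer vectors in the row span of a system of girth k - 1. They form a
  saturated lattice: \<open>R_cancel\<close> reflects that the span is taken over the
  rationals.\<close>

locale girth_module =
  fixes R :: "(nat \<Rightarrow> int) \<Rightarrow> bool" and K k :: nat
  assumes R_lincomb: "R v \<Longrightarrow> R w \<Longrightarrow> R (\<lambda>c. s * v c + t * w c)"
    and R_cancel: "R (\<lambda>c. s * v c) \<Longrightarrow> s \<noteq> 0 \<Longrightarrow> R v"
    and R_cong: "R v \<Longrightarrow> (\<And>c. c < K \<Longrightarrow> v c = w c) \<Longrightarrow> R w"
    and R_girth: "R v \<Longrightarrow> card {c. c < K \<and> v c \<noteq> 0} < k - 1 \<Longrightarrow> c < K \<Longrightarrow> v c = 0"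
    and k_ge: "k \<ge> 4"
begin

text \<open>At most k - 2 nonzero entries remain, fewer than the girth allows. Elements supported in
  a fixed \<open>k\<close>-set are thus determined by any two of their entries there; the rigidity
  arguments below rest on this.\<close>

lemma two_zeros:
  assumes "R v" and S: "S \<subseteq> {..<K}" "card S = k" "\<And>c. c < K \<Longrightarrow> c \<notin> S \<Longrightarrow> v c = 0"
    and "d \<in> S" "e \<in> S" "d \<noteq> e" "v d = 0" "v e = 0" and "c < K"
  shows "v c = 0"
proof -
  have fin: "finite S" using S(1) finite_subset by blast
  have "{c. c < K \<and> v c \<noteq> 0} \<subseteq> S - {d, e}" using assms by auto
  then have "card {c. c < K \<and> v c \<noteq> 0} \<le> card (S - {d, e})"
    using fin by (intro card_mono) auto
  also have "\<dots> = k - 2" using assms fin by (simp add: card_Diff_subset)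
  also have "\<dots> < k - 1" using k_ge by simp
  finally show ?thesis using R_girth assms by blast
qed

text \<open>
  If the claim fails, then three of the vectors \<open>r c * y c\<close> are distinct and collinear, which is
  impossible on a sphere.
\<close>

lemma rank_one_if_on_sphere:
  fixes y :: "nat \<Rightarrow> nat \<Rightarrow> int"
  assumes S: "S \<subseteq> {..<K}" "card S = k"
    and r: "R r" "\<And>c. c \<in> S \<Longrightarrow> r c = 1 \<or> r c = -1" "\<And>c. c < K \<Longrightarrow> c \<notin> S \<Longrightarrow> r c = 0"
    and y: "\<And>j. j < D \<Longrightarrow> R (\<lambda>c. y c j)" "\<And>c j. c < K \<Longrightarrow> c \<notin> S \<Longrightarrow> j < D \<Longrightarrow> y c j = 0"
    and N: "\<And>c. c \<in> S \<Longrightarrow> (\<Sum>j<D. (y c j)\<^sup>2) = N"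
    and c: "c1 \<in> S" "c2 \<in> S" and j0: "j0 < D"
  shows "r c1 * y c1 j0 = r c2 * y c2 j0"
proof (rule ccontr)
  assume ne: "r c1 * y c1 j0 \<noteq> r c2 * y c2 j0"
  then have c12: "c1 \<noteq> c2" by auto
  have "card (S - {c1, c2}) = k - 2"
    using c c12 S by (simp add: card_Diff_subset)
  then have "0 < card (S - {c1, c2})" using k_ge by simp
  then have "S - {c1, c2} \<noteq> {}" by (metis card.empty less_irrefl)
  \<comment> \<open>\<open>k \<ge> 4\<close> leaves a third point, while a line meets a sphere in at
    most two.\<close>
  then obtain c3 where c3: "c3 \<in> S" "c3 \<noteq> c1" "c3 \<noteq> c2" by blast
  have lt: "c1 < K" "c2 < K" "c3 < K" using S c c3 by auto
  have rr: "r c * r c = 1" if "c \<in> S" for c using r(2)[OF that] by auto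
  define z where "z c j = r c * y c j" for c j
  define e where "e c j = z c j - z c1 j" for c j
  have z_norm: "(\<Sum>j<D. (z c j)\<^sup>2) = N" if "c \<in> S" for c
    using N[OF that] rr[OF that] by (simp add: z_def power_mult_distrib power2_eq_square[of "r c"])
  have yz: "y c j - z d j * r c = r c * (z c j - z d j)" if "c \<in> S" for c d j
  proof -
    have "r c * (z c j - z d j) = (r c * r c) * y c j - z d j * r c"
      by (simp add: z_def algebra_simps)
    then show ?thesis using rr[OF that] by simp
  qed
  have Ry: "R (\<lambda>c. y c j - z d j * r c)" if "j < D" for d j
    using R_lincomb[OF y(1)[OF that] r(1), of 1 "- z d j"] by simp
  have zero: "y c j - z d j * r c = 0" if "j < D" "c < K" "c \<notin> S" for c d j
    using that y(2) r(3) by simp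
  \<comment> \<open>The entries \<open>y c j - z d j * r c\<close> form an element of
    \<open>R\<close> that vanishes at \<open>d\<close>; a second zero at \<open>d'\<close> would
    force one at \<open>d''\<close>. So if two of the points agree in coordinate \<open>j\<close>,
    all of them do.\<close>
  have third: "z d' j \<noteq> z d j"
    if "j < D" "d \<in> S" "d' \<in> S" "d'' \<in> S" "d' \<noteq> d" "z d'' j \<noteq> z d j" for d d' d'' j
  proof
    assume eq: "z d' j = z d j"
    have "y d'' j - z d j * r d'' = 0"
    proof (rule two_zeros[OF Ry[OF that(1)] S zero[OF that(1)], of d d'])
      show "y d j - z d j * r d = 0" using yz[OF that(2)] by simp
      show "y d' j - z d j * r d' = 0" using yz[OF that(3)] eq by simp
      show "d'' < K" using S that(4) by blast
    qed (use that in simp_all)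
    then have "r d'' * (z d'' j - z d j) = 0" using yz[OF that(4)] by simp
    then show False using that(6) r(2)[OF that(4)] by auto
  qed
  define \<mu> where "\<mu> = e c2 j0"
  define \<rho> where "\<rho> = e c3 j0"
  have \<mu>: "\<mu> \<noteq> 0" using ne by (simp add: \<mu>_def e_def z_def)
  \<comment> \<open>The combination \<open>v\<close> of two such elements vanishes at
    \<open>c1\<close> and at \<open>c2\<close>. Its zero at \<open>c3\<close> says that
    \<open>e c3\<close> is \<rho> / \<mu> times \<open>e c2\<close>.\<close>
  have coll: "\<mu> * e c3 j = \<rho> * e c2 j" if j: "j < D" for j
  proof -
    define v where "v c = \<mu> * (y c j - z c1 j * r c) + (- e c2 j) * (y c j0 - z c1 j0 * r c)" for c
    have v: "v c = r c * (\<mu> * e c j - e c2 j * e c j0)" if "c \<in> S" for c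
      unfolding v_def yz[OF that] by (simp add: e_def algebra_simps)
    have "R v" unfolding v_def by (rule R_lincomb) (use Ry j j0 in auto)
    then have "v c3 = 0"
      by (rule two_zeros[OF _ S, where d = c1 and e = c2])
         (use c c12 c3 lt zero j j0 in \<open>auto simp: v \<mu>_def e_def, auto simp: v_def\<close>)
    then have "\<mu> * e c3 j - e c2 j * \<rho> = 0" using v[OF c3(1)] rr[OF c3(1)] by (auto simp: \<rho>_def)
    then show ?thesis by (simp add: algebra_simps)
  qed
  \<comment> \<open>A point z c1 + t e c2 on the sphere satisfies 2 t P + t^2 Q = 0. As t = 1 is a
    solution, 2 P = - Q, and only t = 0 and t = 1 remain; \<open>third\<close> excludes both for t =
    \<rho> / \<mu>. The computation below has denominators cleared.\<close>
  define P where "P = (\<Sum>j<D. z c1 j * e c2 j)"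
  define Q where "Q = (\<Sum>j<D. (e c2 j)\<^sup>2)"
  have exp: "(\<Sum>j<D. (z c j)\<^sup>2) = N + 2 * (\<Sum>j<D. z c1 j * e c j) + (\<Sum>j<D. (e c j)\<^sup>2)" for c
  proof -
    have "(\<Sum>j<D. (z c j)\<^sup>2) = (\<Sum>j<D. (z c1 j)\<^sup>2 + 2 * (z c1 j * e c j) + (e c j)\<^sup>2)"
      by (intro sum.cong) (auto simp: e_def power2_eq_square algebra_simps)
    then show ?thesis using z_norm[OF c(1)] by (simp add: sum.distrib sum_distrib_left)
  qed
  have PQ: "2 * P + Q = 0" using exp[of c2] z_norm[OF c(2)] by (simp add: P_def Q_def)
  have "2 * (\<Sum>j<D. z c1 j * e c3 j) + (\<Sum>j<D. (e c3 j)\<^sup>2) = 0"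
    using exp[of c3] z_norm[OF c3(1)] by simp
  then have "0 = \<mu>\<^sup>2 * (2 * (\<Sum>j<D. z c1 j * e c3 j) + (\<Sum>j<D. (e c3 j)\<^sup>2))" by simp
  also have "\<dots> = 2 * \<mu> * (\<Sum>j<D. z c1 j * (\<mu> * e c3 j)) + (\<Sum>j<D. (\<mu> * e c3 j)\<^sup>2)"
    by (simp add: algebra_simps sum_distrib_left power2_eq_square)
  also have "\<dots> = 2 * \<mu> * \<rho> * P + \<rho>\<^sup>2 * Q"
    by (simp add: coll P_def Q_def algebra_simps sum_distrib_left power2_eq_square)
  also have "\<dots> = \<mu> * \<rho> * (2 * P) + \<rho>\<^sup>2 * Q" by simp
  also have "2 * P = - Q" using PQ by simp
  also have "\<mu> * \<rho> * (- Q) + \<rho>\<^sup>2 * Q = \<rho> * (\<rho> - \<mu>) * Q"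
    by (simp add: algebra_simps power2_eq_square)
  finally have "\<rho> * (\<rho> - \<mu>) * Q = 0" by simp
  moreover have "Q > 0"
  proof -
    have "0 < (e c2 j0)\<^sup>2" using \<mu> by (simp add: \<mu>_def)
    also have "\<dots> \<le> Q" unfolding Q_def using j0 by (intro member_le_sum) auto
    finally show ?thesis .
  qed
  moreover have "\<rho> \<noteq> 0"
    using third[OF j0, of c1 c3 c2] c c3 \<mu> by (simp add: \<rho>_def \<mu>_def e_def)
  moreover have "\<rho> \<noteq> \<mu>"
    using third[OF j0, of c2 c3 c1] c c3 \<mu> by (simp add: \<rho>_def \<mu>_def e_def)
  ultimately show False by simp
qed

end

context girth_module
begin

text \<open>Index set of the order \<open>k\<close> terms in the Fourier expansion; the inserted
  zero function is the frequency of the constant term 1/2.\<close>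

definition admissible :: "nat \<Rightarrow> (nat \<Rightarrow> int) set \<Rightarrow> (nat \<Rightarrow> nat \<Rightarrow> int) set" where
  "admissible n T = {V \<in> {..<K} \<rightarrow>\<^sub>E insert (\<lambda>_. 0) T.
     (\<forall>j<n. R (\<lambda>c. V c j)) \<and> card {c. c < K \<and> V c \<noteq> (\<lambda>_. 0)} = k}"

end

section \<open>Frequencies built from the two rows of the subsystem\<close>

locale girth_module_pair = girth_module +
  fixes a b :: "nat \<Rightarrow> int" and S0 :: "nat set"
  assumes S0: "S0 \<subseteq> {..<K}" "card S0 = k"
    and ab: "R a" "R b" "\<And>c. c \<notin> S0 \<Longrightarrow> a c = 0" "\<And>c. c \<notin> S0 \<Longrightarrow> b c = 0"
    and ab_indep: "(\<And>c. c < K \<Longrightarrow> s * a c + t * b c = 0) \<Longrightarrow> s = 0 \<and> t = 0"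
begin

text \<open>If the minor vanishes, then a_c b - b_c a has zeros at \<open>c\<close> and
  \<open>c'\<close>, so it is zero by \<open>two_zeros\<close>, and independence gives a_c = b_c =
  0. A zero column makes every other minor with \<open>c\<close> vanish as well, so all columns are
  zero, against independence.\<close>

lemma det_nonzero:
  assumes c: "c \<in> S0" "c' \<in> S0" "c \<noteq> c'"
  shows "a c * b c' \<noteq> a c' * b c"
proof
  assume det: "a c * b c' = a c' * b c"
  have zero: "a d = 0 \<and> b d = 0" if "d \<in> S0" "d' \<in> S0" "d \<noteq> d'" "a d * b d' = a d' * b d" for d d'
  proof -
    have "R (\<lambda>x. a d * b x + (- b d) * a x)" by (rule R_lincomb) (use ab in auto)
    then have "a d * b x + (- b d) * a x = 0" if "x < K" for x
      by (rule two_zeros[OF _ S0, where d = d and e = d'])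
         (use ab that \<open>d \<in> S0\<close> \<open>d' \<in> S0\<close> \<open>d \<noteq> d'\<close> \<open>a d * b d' = a d' * b d\<close> in \<open>auto simp: algebra_simps\<close>)
    then have "- b d = 0 \<and> a d = 0"
      by (intro ab_indep) (auto simp: algebra_simps)
    then show ?thesis by simp
  qed
  have c0: "a c = 0 \<and> b c = 0" using zero[OF c det] .
  have "a x = 0 \<and> b x = 0" for x
  proof (cases "x \<in> S0")
    case True
    show ?thesis
    proof (cases "x = c")
      case False
      then show ?thesis using zero[of x c] True c c0 by auto
    qed (use c0 in auto)
  qed (use ab in auto)
  then have "1 = (0::int) \<and> 1 = (0::int)" by (intro ab_indep) auto
  then show False by simp
qed

lemma coeff_nonzero:
  assumes "c \<in> S0"
  shows "a c \<noteq> 0 \<or> b c \<noteq> 0"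
proof -
  have "card (S0 - {c}) = k - 1" using S0 assms by simp
  then have "0 < card (S0 - {c})" using k_ge by simp
  then have "S0 - {c} \<noteq> {}" by (metis card.empty less_irrefl)
  then obtain c' where "c' \<in> S0" "c' \<noteq> c" by blast
  then show ?thesis using det_nonzero[of c c'] assms by auto
qed

text \<open>Entries 0 and 1 identify \<open>c\<close> in \<open>S0\<close>, even up to
  proportionality, by \<open>det_nonzero\<close>; entries 2 to 8 carry the point a_c \<xi> + b_c
  \<eta>. Each entry, as a function of \<open>c\<close>, is a combination of \<open>a\<close> and
  \<open>b\<close>, hence lies in the row span.\<close>

definition freq :: "nat \<Rightarrow> (nat \<Rightarrow> int) \<Rightarrow> (nat \<Rightarrow> int) \<Rightarrow> nat \<Rightarrow> int" where
  "freq c \<xi> \<eta> = (\<lambda>j. if j = 0 then a c else if j = 1 then b c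
     else if j < 9 then a c * \<xi> (j - 2) + b c * \<eta> (j - 2) else 0)"

definition freqs :: "((nat \<Rightarrow> int) \<times> (nat \<Rightarrow> int)) set \<Rightarrow> (nat \<Rightarrow> int) set" where
  "freqs P = {u. \<exists>s c \<xi> \<eta>. (s = 1 \<or> s = -1) \<and> c \<in> S0 \<and> (\<xi>, \<eta>) \<in> P \<and> u = (\<lambda>j. s * freq c \<xi> \<eta> j)}"

text \<open>Among \<open>freqs\<close>, the vanishing determinant detects exactly the frequencies of
  index \<open>c0\<close>, by \<open>det_nonzero\<close>. The test is invariant under negation of
  \<open>u\<close>.\<close>

definition sign :: "nat \<Rightarrow> (nat \<Rightarrow> int) \<Rightarrow> int" where
  "sign c0 u = (if u 0 * b c0 = a c0 * u 1 then -1 else 1)"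

lemma sign_uminus: "sign c0 (\<lambda>j. - u j) = sign c0 u"
  by (simp add: sign_def)

lemma freqs_uminus:
  assumes "u \<in> freqs P" shows "(\<lambda>j. - u j) \<in> freqs P"
proof -
  obtain s c \<xi> \<eta> where *: "s = 1 \<or> s = -1" "c \<in> S0" "(\<xi>, \<eta>) \<in> P" "u = (\<lambda>j. s * freq c \<xi> \<eta> j)"
    using assms unfolding freqs_def by blast
  show ?thesis unfolding freqs_def
    by (rule CollectI, rule exI[of _ "- s"], rule exI[of _ c], rule exI[of _ \<xi>], rule exI[of _ \<eta>]) (use * in auto)
qed

lemma freqs_nonzero: "u \<in> freqs P \<Longrightarrow> u 0 \<noteq> 0 \<or> u 1 \<noteq> 0"
  using coeff_nonzero by (auto simp: freqs_def freq_def)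

text \<open>The Gram matrix is common to all pairs in \<open>P\<close>, so the frequencies of one
  index lie on one sphere in their last seven entries.\<close>

lemma freqs_E:
  assumes "u \<in> freqs P"
    and P: "\<And>\<xi> \<eta>. (\<xi>, \<eta>) \<in> P \<Longrightarrow>
      (\<Sum>j<7. (\<xi> j)\<^sup>2) = q1 \<and> (\<Sum>j<7. (\<eta> j)\<^sup>2) = q2 \<and> (\<Sum>j<7. \<xi> j * \<eta> j) = q3"
  shows "\<exists>s c. (s = 1 \<or> s = -1) \<and> c \<in> S0 \<and> u 0 = s * a c \<and> u 1 = s * b c \<and>
    (\<Sum>j<7. (u (j + 2))\<^sup>2) = (a c)\<^sup>2 * q1 + (b c)\<^sup>2 * q2 + 2 * a c * b c * q3"
proof -
  obtain s c \<xi> \<eta> where *: "s = 1 \<or> s = -1" "c \<in> S0" "(\<xi>, \<eta>) \<in> P" "u = (\<lambda>j. s * freq c \<xi> \<eta> j)"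
    using assms unfolding freqs_def by blast
  have "(\<Sum>j<7. (u (j + 2))\<^sup>2) =
      (\<Sum>j<7. (a c)\<^sup>2 * (\<xi> j)\<^sup>2 + (b c)\<^sup>2 * (\<eta> j)\<^sup>2 + 2 * a c * b c * (\<xi> j * \<eta> j))"
    using *(1) by (intro sum.cong) (auto simp: *(4) freq_def power2_eq_square algebra_simps)
  also have "\<dots> = (a c)\<^sup>2 * q1 + (b c)\<^sup>2 * q2 + 2 * a c * b c * q3"
    using P[OF *(3)] by (simp add: sum.distrib flip: sum_distrib_left)
  finally show ?thesis using * by (intro exI[of _ s] exI[of _ c]) (auto simp: freq_def)
qed

text \<open>Let \<open>\<pi> c\<close> be the index of \<open>V c\<close>. If \<pi> is injective, it
  is a bijection onto \<open>S0\<close> and exactly one factor is -1. If two indices agree,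
  \<open>two_zeros\<close> makes all of them equal, the signs themselves form an element of
  \<open>R\<close>, and \<open>rank_one_if_on_sphere\<close> makes the nonzero entries equal up to
  sign.\<close>

lemma admissible_cases:
  assumes V: "V \<in> admissible 9 (freqs P)" and c0: "c0 \<in> S0"
    and P: "\<And>\<xi> \<eta>. (\<xi>, \<eta>) \<in> P \<Longrightarrow>
      (\<Sum>j<7. (\<xi> j)\<^sup>2) = q1 \<and> (\<Sum>j<7. (\<eta> j)\<^sup>2) = q2 \<and> (\<Sum>j<7. \<xi> j * \<eta> j) = q3"
  shows "(\<Prod>c | c < K \<and> V c \<noteq> (\<lambda>_. 0). sign c0 (V c)) = -1 \<or>
    (\<exists>u\<in>freqs P. \<forall>c<K. V c \<in> {\<lambda>_. 0, u, \<lambda>j. - u j})"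
proof -
  define S where "S = {c. c < K \<and> V c \<noteq> (\<lambda>_. 0)}"
  have S: "S \<subseteq> {..<K}" "card S = k" and RV: "\<And>j. j < 9 \<Longrightarrow> R (\<lambda>c. V c j)"
    and V0: "\<And>c j. c < K \<Longrightarrow> c \<notin> S \<Longrightarrow> V c j = 0"
    using V by (auto simp: admissible_def S_def)
  have finS: "finite S" and finS0: "finite S0" using S S0 finite_subset by blast+
  have VT: "V c \<in> freqs P" if "c \<in> S" for c
    using V that by (auto simp: admissible_def S_def PiE_iff)
  define Q where "Q c s d \<longleftrightarrow> (s = 1 \<or> s = -1) \<and> d \<in> S0 \<and> V c 0 = s * a d \<and> V c 1 = s * b d \<and>
    (\<Sum>j<7. (V c (j + 2))\<^sup>2) = (a d)\<^sup>2 * q1 + (b d)\<^sup>2 * q2 + 2 * a d * b d * q3" for c s d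
  have "\<forall>c\<in>S. \<exists>s d. Q c s d"
    unfolding Q_def using freqs_E[OF VT P] by blast
  then obtain s \<pi> where "\<forall>c\<in>S. Q c (s c) (\<pi> c)" by metis
  then have s: "\<And>c. c \<in> S \<Longrightarrow> s c = 1 \<or> s c = -1" and \<pi>: "\<And>c. c \<in> S \<Longrightarrow> \<pi> c \<in> S0"
    and V01: "\<And>c. c \<in> S \<Longrightarrow> V c 0 = s c * a (\<pi> c)" "\<And>c. c \<in> S \<Longrightarrow> V c 1 = s c * b (\<pi> c)"
    and Vn: "\<And>c. c \<in> S \<Longrightarrow> (\<Sum>j<7. (V c (j + 2))\<^sup>2) =
        (a (\<pi> c))\<^sup>2 * q1 + (b (\<pi> c))\<^sup>2 * q2 + 2 * a (\<pi> c) * b (\<pi> c) * q3"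
    unfolding Q_def by blast+
  show ?thesis
  proof (cases "inj_on \<pi> S")
    case True
    have "\<pi> ` S = S0"
      using True \<pi> S S0 finS0 by (intro card_subset_eq) (auto simp: card_image)
    have "sign c0 (V c) = (if \<pi> c = c0 then -1 else 1)" if "c \<in> S" for c
      using det_nonzero[OF \<pi>[OF that] c0] s[OF that] V01[OF that]
      by (auto simp: sign_def)
    then have "(\<Prod>c\<in>S. sign c0 (V c)) = (\<Prod>c\<in>S. (\<lambda>d. if d = c0 then -1 else 1) (\<pi> c))"
      by (intro prod.cong) auto
    also have "\<dots> = (\<Prod>d\<in>S0. if d = c0 then -1 else 1)"
      using prod.reindex[OF True, of "\<lambda>d. if d = c0 then -1 else (1::int)"] \<open>\<pi> ` S = S0\<close> by simp
    also have "\<dots> = -1" using c0 finS0 by simp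
    finally show ?thesis by (simp add: S_def)
  next
    case False
    then obtain c1 c2 where c12: "c1 \<in> S" "c2 \<in> S" "c1 \<noteq> c2" "\<pi> c1 = \<pi> c2"
      by (auto simp: inj_on_def)
    define i where "i = \<pi> c1"
    have i: "i \<in> S0" using \<pi> c12 by (simp add: i_def)
    \<comment> \<open>At \<open>c1\<close> and \<open>c2\<close> entries 0 and 1 are proportional to
      (a_i, b_i), so this combination vanishes there, hence everywhere; then
      \<open>det_nonzero\<close> excludes every index other than \<open>i\<close>.\<close>
    have "R (\<lambda>c. a i * V c 1 + (- b i) * V c 0)"
      by (rule R_lincomb) (use RV in auto)
    then have par: "a i * V c 1 + (- b i) * V c 0 = 0" if "c < K" for c
      by (rule two_zeros[OF _ S, where d = c1 and e = c2]) (use V0 V01 c12 that in \<open>auto simp: i_def\<close>)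
    have \<pi>i: "\<pi> c = i" if "c \<in> S" for c
    proof (rule ccontr)
      assume ne: "\<pi> c \<noteq> i"
      have "c < K" using S that by auto
      then show False
        using par[of c] det_nonzero[OF i \<pi>[OF that]] ne s[OF that] V01[OF that] by auto
    qed
    \<comment> \<open>Entry 0 of \<open>V\<close> is a_i times this sign vector and entry 1 is b_i
      times it; cancelling the nonzero one of the two factors puts \<open>r\<close> into
      \<open>R\<close>.\<close>
    define r where "r c = (if c \<in> S then s c else 0)" for c
    have "R r"
    proof (cases "a i = 0")
      case False
      have "R (\<lambda>c. a i * r c)"
        by (rule R_cong[OF RV[of 0]]) (use V0 V01 \<pi>i in \<open>auto simp: r_def\<close>)
      then show ?thesis using False by (rule R_cancel)
    next
      case True
      have "R (\<lambda>c. b i * r c)"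
        by (rule R_cong[OF RV[of 1]]) (use V0 V01 \<pi>i in \<open>auto simp: r_def\<close>)
      then show ?thesis by (rule R_cancel) (use True coeff_nonzero[OF i] in simp)
    qed
    have r1: "r c1 * V c1 (j + 2) = r c * V c (j + 2)" if "c \<in> S" "j < 7" for c j
    proof (rule rank_one_if_on_sphere[OF S \<open>R r\<close>, where D = 7 and y = "\<lambda>c j. V c (j + 2)"])
      show "r c = 1 \<or> r c = -1" if "c \<in> S" for c using s that by (simp add: r_def)
      show "R (\<lambda>c. V c (j + 2))" if "j < 7" for j using RV[of "j + 2"] that by simp
      show "(\<Sum>j<7. (V c (j + 2))\<^sup>2) = (a i)\<^sup>2 * q1 + (b i)\<^sup>2 * q2 + 2 * a i * b i * q3" if "c \<in> S" for c
        using Vn[OF that] \<pi>i[OF that] by simp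
    qed (use V0 c12 that in \<open>simp_all add: r_def\<close>)
    \<comment> \<open>Needed to turn agreement on nine entries into equality of functions on all
      naturals.\<close>
    have V9: "V c j = 0" if "c \<in> S" "j \<ge> 9" for c j
      using VT[OF that(1)] that(2) by (auto simp: freqs_def freq_def)
    have rV: "r c1 * V c1 j = r c * V c j" if c: "c \<in> S" for c j
    proof -
      have ss: "s c * s c = 1" "s c1 * s c1 = 1" using s[OF c] s[OF c12(1)] by auto
      consider "j = 0" | "j = 1" | j' where "j = j' + 2" "j' < 7" | "j \<ge> 9"
      proof -
        have "j = 0 \<or> j = 1 \<or> (\<exists>j'. j = j' + 2 \<and> j' < 7) \<or> j \<ge> 9" by presburger
        then show ?thesis using that by blast
      qed
      then show ?thesis
      proof cases
        case 3
        then show ?thesis using r1[OF c] by simp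
      qed (use V9[OF c] V9[OF c12(1)] V01[OF c] V01[OF c12(1)] ss \<pi>i c c12 in
          \<open>auto simp: r_def simp flip: mult.assoc\<close>)
    qed
    have "V c \<in> {\<lambda>_. 0, V c1, \<lambda>j. - V c1 j}" if "c < K" for c
    proof (cases "c \<in> S")
      case True
      have "V c = V c1 \<or> V c = (\<lambda>j. - V c1 j)"
        using rV[OF True] s[OF True] s[OF c12(1)] True c12(1) by (auto simp: r_def fun_eq_iff)
      then show ?thesis by blast
    qed (use that in \<open>auto simp: S_def\<close>)
    then show ?thesis using VT[OF c12(1)] by blast
  qed
qed

end

section \<open>Counting the concentrated tuples against all admissible ones\<close>

lemma card_concentrated_tuples:
  fixes T :: "(nat \<Rightarrow> int) set"
  assumes "finite T"
  shows "card {V \<in> {..<K::nat} \<rightarrow>\<^sub>E insert (\<lambda>_. 0) T. \<exists>u\<in>T. \<forall>c<K. V c \<in> {\<lambda>_. 0, u, \<lambda>j. - u j}}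
    \<le> card T * 3 ^ K"
proof -
  define F where "F u = {..<K} \<rightarrow>\<^sub>E {\<lambda>_. 0, u, \<lambda>j. - u j}" for u :: "nat \<Rightarrow> int"
  have "{V \<in> {..<K} \<rightarrow>\<^sub>E insert (\<lambda>_. 0) T. \<exists>u\<in>T. \<forall>c<K. V c \<in> {\<lambda>_. 0, u, \<lambda>j. - u j}} \<subseteq> (\<Union>u\<in>T. F u)"
  proof clarify
    fix V and u :: "nat \<Rightarrow> int" assume "V \<in> {..<K} \<rightarrow>\<^sub>E insert (\<lambda>_. 0) T" "u \<in> T" "\<forall>c<K. V c \<in> {\<lambda>_. 0, u, \<lambda>j. - u j}"
    then have "V \<in> F u" unfolding F_def PiE_iff by blast
    then show "V \<in> (\<Union>u\<in>T. F u)" using \<open>u \<in> T\<close> by blast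
  qed
  then have "card {V \<in> {..<K} \<rightarrow>\<^sub>E insert (\<lambda>_. 0) T. \<exists>u\<in>T. \<forall>c<K. V c \<in> {\<lambda>_. 0, u, \<lambda>j. - u j}}
      \<le> card (\<Union>u\<in>T. F u)"
    using assms by (intro card_mono) (auto simp: F_def intro!: finite_PiE)
  also have "\<dots> \<le> (\<Sum>u\<in>T. card (F u))" by (rule card_UN_le[OF assms])
  also have "\<dots> \<le> (\<Sum>u\<in>T. 3 ^ K)"
  proof (rule sum_mono)
    fix u :: "nat \<Rightarrow> int"
    have "card {\<lambda>_. 0, u, \<lambda>j. - u j} \<le> 3" by (simp add: card_insert_if)
    then show "card (F u) \<le> 3 ^ K" by (simp add: F_def card_PiE power_mono)
  qed
  finally show ?thesis by simp
qed

context girth_module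
begin

lemma finite_admissible: "finite T \<Longrightarrow> finite (admissible n T)"
  unfolding admissible_def by (rule finite_subset[OF _ finite_PiE[of "{..<K}" "\<lambda>_. insert (\<lambda>_. 0) T"]]) auto

end

context girth_module_pair
begin

text \<open>A frequency is determined by its sign, its index and a lattice point of the box
  [-B M, B M]^7. Counting these points instead of the pairs \<xi>, \<eta> gives order M^7, below the
  size of a popular class.\<close>

lemma card_freqs:
  assumes P: "P \<subseteq> ({..<7} \<rightarrow>\<^sub>E {0..<int M}) \<times> ({..<7} \<rightarrow>\<^sub>E {0..<int M})"
    and B: "\<And>c. c \<in> S0 \<Longrightarrow> \<bar>a c\<bar> + \<bar>b c\<bar> \<le> int B"
  shows "finite (freqs P)" "card (freqs P) \<le> 2 * k * (2 * B * M + 1) ^ 7"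
proof -
  define Y where "Y = ({..<7::nat} \<rightarrow>\<^sub>E {- int (B * M)..int (B * M)})"
  define f :: "int \<times> nat \<times> (nat \<Rightarrow> int) \<Rightarrow> nat \<Rightarrow> int" where
    "f = (\<lambda>(s, c, y) j. s * (if j = 0 then a c else if j = 1 then b c else if j < 9 then y (j - 2) else 0))"
  have finS0: "finite S0" using S0 finite_subset by blast
  have fin: "finite ({1, -1} \<times> S0 \<times> Y)" using finS0 by (auto simp: Y_def intro!: finite_PiE)
  have sub: "freqs P \<subseteq> f ` ({1, -1} \<times> S0 \<times> Y)"
  proof
    fix u assume "u \<in> freqs P"
    then obtain s c \<xi> \<eta> where *: "s = 1 \<or> s = -1" "c \<in> S0" "(\<xi>, \<eta>) \<in> P" "u = (\<lambda>j. s * freq c \<xi> \<eta> j)"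
      unfolding freqs_def by blast
    have \<xi>\<eta>: "\<xi> \<in> {..<7} \<rightarrow>\<^sub>E {0..<int M}" "\<eta> \<in> {..<7} \<rightarrow>\<^sub>E {0..<int M}" using * P by auto
    define y where "y = restrict (\<lambda>j. a c * \<xi> j + b c * \<eta> j) {..<7}"
    have "\<bar>a c * \<xi> j + b c * \<eta> j\<bar> \<le> int (B * M)" if "j < 7" for j
    proof -
      have x: "\<xi> j \<in> {0..<int M}" "\<eta> j \<in> {0..<int M}" using \<xi>\<eta> that by blast+
      have "\<bar>a c * \<xi> j + b c * \<eta> j\<bar> \<le> \<bar>a c\<bar> * \<bar>\<xi> j\<bar> + \<bar>b c\<bar> * \<bar>\<eta> j\<bar>"
        using abs_triangle_ineq[of "a c * \<xi> j" "b c * \<eta> j"] by (simp add: abs_mult)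
      also have "\<dots> \<le> \<bar>a c\<bar> * int M + \<bar>b c\<bar> * int M"
        using x by (intro add_mono mult_left_mono) auto
      also have "\<dots> \<le> int B * int M"
        using B[OF *(2)] by (simp add: mult_right_mono flip: distrib_right)
      finally show ?thesis by simp
    qed
    then have "a c * \<xi> j + b c * \<eta> j \<in> {- int (B * M)..int (B * M)}" if "j < 7" for j
      using that unfolding atLeastAtMost_iff abs_le_iff by (metis minus_le_iff)
    then have "y \<in> Y" unfolding y_def Y_def by (simp add: restrict_PiE_iff)
    moreover have "u = f (s, c, y)"
      unfolding *(4) by (auto simp: f_def freq_def y_def fun_eq_iff)
    ultimately show "u \<in> f ` ({1, -1} \<times> S0 \<times> Y)" using *(1,2) by blast
  qed
  show "finite (freqs P)" using fin sub finite_surj by blast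
  have "card (freqs P) \<le> card (f ` ({1, -1} \<times> S0 \<times> Y))"
    using fin sub by (intro card_mono) auto
  also have "\<dots> \<le> card ({1, -1::int} \<times> S0 \<times> Y)" by (rule card_image_le[OF fin])
  also have "\<dots> = 2 * k * card Y" using S0 by (simp add: card_cartesian_product)
  also have "card Y = (2 * B * M + 1) ^ 7"
  proof -
    have "card {- int (B * M)..int (B * M)} = nat (int (2 * B * M + 1))"
      by (simp add: algebra_simps)
    then have "card {- int (B * M)..int (B * M)} = 2 * B * M + 1" by (simp only: nat_int)
    then show ?thesis unfolding Y_def by (simp only: card_PiE[OF finite_lessThan] prod_constant card_lessThan)
  qed
  finally show "card (freqs P) \<le> 2 * k * (2 * B * M + 1) ^ 7" .
qed

text \<open>Each pair \<xi>, \<eta> yields the tuple with entry \<open>freq c \<xi> \<eta>\<close>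
  at every \<open>c\<close> in \<open>S0\<close>. Two indices suffice to recover the pair, because
  their minor is nonzero.\<close>

lemma card_admissible_ge:
  assumes P: "P \<subseteq> ({..<7} \<rightarrow>\<^sub>E {0..<int M}) \<times> ({..<7} \<rightarrow>\<^sub>E {0..<int M})"
    and fin: "finite (freqs P)"
  shows "card P \<le> card (admissible 9 (freqs P))"
proof -
  define F :: "(nat \<Rightarrow> int) \<times> (nat \<Rightarrow> int) \<Rightarrow> nat \<Rightarrow> nat \<Rightarrow> int" where
    "F = (\<lambda>(\<xi>, \<eta>). \<lambda>c\<in>{..<K}. if c \<in> S0 then freq c \<xi> \<eta> else (\<lambda>_. 0))"
  have nz: "freq c \<xi> \<eta> \<noteq> (\<lambda>_. 0)" if "c \<in> S0" for c \<xi> \<eta>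
  proof
    assume "freq c \<xi> \<eta> = (\<lambda>_. 0)"
    then have "freq c \<xi> \<eta> 0 = 0" "freq c \<xi> \<eta> 1 = 0" by simp_all
    then show False using coeff_nonzero[OF that] by (simp add: freq_def)
  qed
  have "F (\<xi>, \<eta>) \<in> admissible 9 (freqs P)" if "(\<xi>, \<eta>) \<in> P" for \<xi> \<eta>
    unfolding admissible_def
  proof (intro CollectI conjI allI impI)
    have "freq c \<xi> \<eta> \<in> freqs P" if "c \<in> S0" for c
      unfolding freqs_def
      by (rule CollectI, rule exI[of _ 1], rule exI[of _ c], rule exI[of _ \<xi>], rule exI[of _ \<eta>])
         (use that \<open>(\<xi>, \<eta>) \<in> P\<close> in auto)
    then show "F (\<xi>, \<eta>) \<in> {..<K} \<rightarrow>\<^sub>E insert (\<lambda>_. 0) (freqs P)"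
      by (auto simp: F_def)
    have "{c. c < K \<and> F (\<xi>, \<eta>) c \<noteq> (\<lambda>_. 0)} = S0"
      using nz S0 by (auto simp: F_def)
    then show "card {c. c < K \<and> F (\<xi>, \<eta>) c \<noteq> (\<lambda>_. 0)} = k" using S0 by simp
  next
    fix j :: nat assume "j < 9"
    \<comment> \<open>Coordinate \<open>j\<close> of the tuple is s a + t b: one of the rows for j =
      0, 1, and afterwards the combination given by a coordinate of \<xi> and \<eta>.\<close>
    define s t where "s = (if j = 0 then 1 else if j = 1 then 0 else \<xi> (j - 2))"
      and "t = (if j = 0 then 0 else if j = 1 then 1 else \<eta> (j - 2))"
    have "R (\<lambda>c. s * a c + t * b c)" by (rule R_lincomb) (use ab in auto)
    then show "R (\<lambda>c. F (\<xi>, \<eta>) c j)"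
      by (rule R_cong) (use \<open>j < 9\<close> ab in \<open>auto simp: F_def freq_def s_def t_def\<close>)
  qed
  then have "F ` P \<subseteq> admissible 9 (freqs P)" by auto
  moreover have "inj_on F P"
  proof (rule inj_onI, clarify)
    fix \<xi> \<eta> \<xi>' \<eta>'
    assume in_P: "(\<xi>, \<eta>) \<in> P" "(\<xi>', \<eta>') \<in> P" and eq: "F (\<xi>, \<eta>) = F (\<xi>', \<eta>')"
    have "0 < card S0" using S0 k_ge by simp
    then obtain c where c: "c \<in> S0" by (metis card.empty less_irrefl all_not_in_conv)
    have "0 < card (S0 - {c})" using S0 k_ge c by simp
    then obtain d where d: "d \<in> S0" "c \<noteq> d" by (metis card.empty less_irrefl all_not_in_conv Diff_iff singletonI)
    have "\<xi> j = \<xi>' j \<and> \<eta> j = \<eta>' j" if j: "j < 7" for j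
    proof -
      have e: "a x * \<xi> j + b x * \<eta> j = a x * \<xi>' j + b x * \<eta>' j" if "x \<in> S0" for x
      proof -
        have "F (\<xi>, \<eta>) x (j + 2) = F (\<xi>', \<eta>') x (j + 2)" using eq by simp
        then show ?thesis using that S0 j by (auto simp: F_def freq_def)
      qed
      define x y where "x = \<xi> j - \<xi>' j" and "y = \<eta> j - \<eta>' j"
      have xy: "a c * x + b c * y = 0" "a d * x + b d * y = 0"
        using e[OF c] e[OF d(1)] by (simp_all add: x_def y_def algebra_simps)
      \<comment> \<open>Cramer's rule for the two equations in \<open>xy\<close>.\<close>
      have "(a c * b d - a d * b c) * x = b d * (a c * x + b c * y) - b c * (a d * x + b d * y)"
        "(a c * b d - a d * b c) * y = a c * (a d * x + b d * y) - a d * (a c * x + b c * y)"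
        by (simp_all add: algebra_simps)
      then have "(a c * b d - a d * b c) * x = 0" "(a c * b d - a d * b c) * y = 0"
        unfolding xy by simp_all
      then have "x = 0" "y = 0" using det_nonzero[OF c d(1) d(2)] by simp_all
      then show ?thesis by (simp add: x_def y_def)
    qed
    moreover have "\<xi> j = \<xi>' j \<and> \<eta> j = \<eta>' j" if "\<not> j < 7" for j
    proof -
      have "\<xi> \<in> extensional {..<7}" "\<xi>' \<in> extensional {..<7}"
        "\<eta> \<in> extensional {..<7}" "\<eta>' \<in> extensional {..<7}"
        using in_P P by (auto simp: PiE_def)
      then show ?thesis using that by (simp add: extensional_def)
    qed
    ultimately show "\<xi> = \<xi>' \<and> \<eta> = \<eta>'" by (metis ext)
  qed
  ultimately show ?thesis using finite_admissible[OF fin] by (metis card_image card_mono)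
qed

text \<open>Concentrated tuples contribute at most 1 each and all others exactly -1; for a popular
  class the former are fewer than half of all.\<close>

lemma exists_negative_frequencies:
  obtains T and g :: "(nat \<Rightarrow> int) \<Rightarrow> int" where "finite T" "\<And>u. \<bar>g u\<bar> = 1" "\<And>u. g (\<lambda>j. - u j) = g u"
    "\<And>u. u \<in> T \<Longrightarrow> (\<lambda>j. - u j) \<in> T" "\<And>u. u \<in> T \<Longrightarrow> \<exists>j<9. u j \<noteq> 0"
    "(\<Sum>V\<in>admissible 9 T. \<Prod>c | c < K \<and> V c \<noteq> (\<lambda>_. 0). g (V c)) < 0"
proof -
  have finS0: "finite S0" using S0 finite_subset by blast
  have "0 < card S0" using S0 k_ge by simp
  then obtain c0 where c0: "c0 \<in> S0" by (metis card.empty less_irrefl all_not_in_conv)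
  define B where "B = nat (\<Sum>c\<in>S0. \<bar>a c\<bar> + \<bar>b c\<bar>)"
  have B: "\<bar>a c\<bar> + \<bar>b c\<bar> \<le> int B" if "c \<in> S0" for c
    using member_le_sum[OF that, of "\<lambda>c. \<bar>a c\<bar> + \<bar>b c\<bar>"] finS0
    by (simp add: B_def sum_nonneg)
  \<comment> \<open>The left side is twice the bound 2 k (2 B M + 1)^7 3^K on the number of
    concentrated tuples.\<close>
  obtain M q1 q2 q3 where big: "2 * (2 * k) * 3 ^ K * (2 * B * M + 1) ^ 7 < card {(\<xi>, \<eta>) \<in> ({..<7::nat} \<rightarrow>\<^sub>E {0..<int M}) \<times> ({..<7} \<rightarrow>\<^sub>E {0..<int M}).
      (\<Sum>j<7. (\<xi> j)\<^sup>2) = q1 \<and> (\<Sum>j<7. (\<eta> j)\<^sup>2) = q2 \<and> (\<Sum>j<7. \<xi> j * \<eta> j) = q3}"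
    by (rule popular_gram_matrix[of "2 * (2 * k) * 3 ^ K" B]) (rule that)
  define P where "P = {(\<xi>, \<eta>) \<in> ({..<7::nat} \<rightarrow>\<^sub>E {0..<int M}) \<times> ({..<7} \<rightarrow>\<^sub>E {0..<int M}).
      (\<Sum>j<7. (\<xi> j)\<^sup>2) = q1 \<and> (\<Sum>j<7. (\<eta> j)\<^sup>2) = q2 \<and> (\<Sum>j<7. \<xi> j * \<eta> j) = q3}"
  have PX: "P \<subseteq> ({..<7} \<rightarrow>\<^sub>E {0..<int M}) \<times> ({..<7} \<rightarrow>\<^sub>E {0..<int M})"
    by (auto simp: P_def)
  have Pq: "(\<Sum>j<7. (\<xi> j)\<^sup>2) = q1 \<and> (\<Sum>j<7. (\<eta> j)\<^sup>2) = q2 \<and> (\<Sum>j<7. \<xi> j * \<eta> j) = q3"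
    if "(\<xi>, \<eta>) \<in> P" for \<xi> \<eta>
    using that by (simp add: P_def)
  define T where "T = freqs P"
  have finT: "finite T" and cardT: "card T \<le> 2 * k * (2 * B * M + 1) ^ 7"
    unfolding T_def using card_freqs[OF PX B] by auto
  define A where "A = admissible 9 T"
  define E where "E = {V \<in> A. \<exists>u\<in>T. \<forall>c<K. V c \<in> {\<lambda>_. 0, u, \<lambda>j. - u j}}"
  define w where "w V = (\<Prod>c | c < K \<and> V c \<noteq> (\<lambda>_. 0). sign c0 (V c))" for V :: "nat \<Rightarrow> nat \<Rightarrow> int"
  have finA: "finite A" unfolding A_def by (rule finite_admissible[OF finT])
  have "card E \<le> card {V \<in> {..<K} \<rightarrow>\<^sub>E insert (\<lambda>_. 0) T. \<exists>u\<in>T. \<forall>c<K. V c \<in> {\<lambda>_. 0, u, \<lambda>j. - u j}}"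
    by (rule card_mono, rule finite_subset[OF _ finite_PiE[of "{..<K}" "\<lambda>_. insert (\<lambda>_. 0) T"]])
       (use finT in \<open>auto simp: E_def A_def admissible_def\<close>)
  also have "\<dots> \<le> card T * 3 ^ K" by (rule card_concentrated_tuples[OF finT])
  also have "\<dots> \<le> 2 * k * (2 * B * M + 1) ^ 7 * 3 ^ K" using cardT by (rule mult_right_mono) simp
  finally have "2 * card E \<le> 2 * (2 * k) * 3 ^ K * (2 * B * M + 1) ^ 7" by (simp add: mult_ac)
  also have "\<dots> < card P" using big by (simp add: P_def)
  also have "card P \<le> card A"
    unfolding A_def T_def by (rule card_admissible_ge[OF PX]) (use finT in \<open>simp add: T_def\<close>)
  finally have less: "2 * card E < card A" .
  have abs_w: "\<bar>w V\<bar> = 1" for V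
    unfolding w_def abs_prod by (rule prod.neutral) (auto simp: sign_def)
  have "(\<Sum>V\<in>A. w V) = (\<Sum>V\<in>E. w V) + (\<Sum>V\<in>A - E. w V)"
    using sum.subset_diff[of E A w] finA by (simp add: E_def add.commute)
  also have "(\<Sum>V\<in>E. w V) \<le> (\<Sum>V\<in>E. 1)" 
  proof (rule sum_mono)
    fix V show "w V \<le> 1" using abs_w[of V] by linarith
  qed
  also have "(\<Sum>V\<in>A - E. w V) = (\<Sum>V\<in>A - E. -1)"
  proof (rule sum.cong)
    fix V assume V: "V \<in> A - E"
    then have "V \<in> admissible 9 (freqs P)" by (simp add: A_def T_def)
    from admissible_cases[OF this c0 Pq] show "w V = -1"
      using V unfolding w_def E_def T_def by blast
  qed simp
  finally have "(\<Sum>V\<in>A. w V) \<le> int (card E) - int (card (A - E))" by simp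
  also have "card (A - E) = card A - card E"
    using finA by (intro card_Diff_subset) (auto simp: E_def intro: finite_subset)
  also have "int (card E) - int (card A - card E) < 0" using less by simp
  finally have "(\<Sum>V\<in>A. w V) < 0" .
  moreover have "\<exists>j<9. u j \<noteq> 0" if "u \<in> T" for u
  proof -
    have "(0::nat) < 9" "(1::nat) < 9" by simp_all
    then show ?thesis using freqs_nonzero that unfolding T_def by blast
  qed
  moreover have "\<bar>sign c0 u\<bar> = 1" for u by (simp add: sign_def)
  moreover have "(\<lambda>j. - u j) \<in> T" if "u \<in> T" for u
    using that freqs_uminus by (simp add: T_def)
  ultimately show ?thesis
    using that[of T "sign c0"] finT sign_uminus unfolding A_def w_def by blast
qed

end

section \<open>Fourier expansion of the solution density\<close>

definition dot :: "nat \<Rightarrow> (nat \<Rightarrow> int) \<Rightarrow> int vec \<Rightarrow> int" where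
  "dot n u x = (\<Sum>j<n. u j * x $ j)"

definition add_char :: "nat \<Rightarrow> int \<Rightarrow> complex" where
  "add_char p z = cis (2 * pi * of_int z / of_nat p)"

lemma add_char_add: "add_char p (y + z) = add_char p y * add_char p z"
  by (simp add: add_char_def cis_mult add_divide_distrib algebra_simps)

lemma add_char_sum: "add_char p (\<Sum>c\<in>A. z c) = (\<Prod>c\<in>A. add_char p (z c))"
  by (induction A rule: infinite_finite_induct) (simp_all add: add_char_add, simp_all add: add_char_def)

lemma add_char_eq_1_iff:
  assumes "p > 0"
  shows "add_char p z = 1 \<longleftrightarrow> int p dvd z"
proof
  assume "add_char p z = 1"
  then have "cos (2 * pi * of_int z / of_nat p) = 1"
    by (simp add: add_char_def complex_eq_iff)
  then obtain k :: int where "2 * pi * of_int z / of_nat p = k * 2 * pi"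
    by (auto simp: cos_one_2pi_int)
  then have "real_of_int z = of_int (k * int p)" using assms by (simp add: field_simps)
  then show "int p dvd z" by (simp only: of_int_eq_iff) simp
next
  assume "int p dvd z"
  then obtain k where "z = int p * k" by blast
  then have "2 * pi * of_int z / of_nat p = 2 * pi * of_int k" using assms by simp
  then show "add_char p z = 1" by (simp add: add_char_def)
qed

lemma add_char_mod:
  assumes "p > 0" "[y = z] (mod int p)"
  shows "add_char p y = add_char p z"
proof -
  have "add_char p (y - z) = 1"
    using assms by (simp add: add_char_eq_1_iff cong_iff_dvd_diff)
  then show ?thesis using add_char_add[of p "y - z" z] by simp
qed

lemma finite_Fp_space: "finite (Fp_space p n)"
proof -
  have "Fp_space p n \<subseteq> (\<lambda>f. vec n f) ` ({..<n} \<rightarrow>\<^sub>E {0..<int p})"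
  proof
    fix v assume v: "v \<in> Fp_space p n"
    then have "v = vec n (restrict (($) v) {..<n})"
      by (intro eq_vecI) (auto simp: Fp_space_def)
    moreover have "restrict (($) v) {..<n} \<in> {..<n} \<rightarrow>\<^sub>E {0..<int p}"
      using v by (auto simp: Fp_space_def)
    ultimately show "v \<in> (\<lambda>f. vec n f) ` ({..<n} \<rightarrow>\<^sub>E {0..<int p})" by blast
  qed
  then show ?thesis by (rule finite_subset) (auto intro!: finite_PiE)
qed

lemma finite_solutions: "finite (solutions p n L)"
  unfolding solutions_def
  by (rule finite_subset[OF _ finite_PiE[of "{..<dim_col L}" "\<lambda>_. Fp_space p n"]])
     (auto simp: finite_Fp_space)

lemma vec_mod_in_Fp_space: "p > 0 \<Longrightarrow> vec n (\<lambda>j. f j mod int p) \<in> Fp_space p n"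
  by (simp add: Fp_space_def)

lemma solutions_nonempty:
  assumes "p > 0" shows "solutions p n L \<noteq> {}"
proof -
  have "(\<lambda>c\<in>{..<dim_col L}. 0\<^sub>v n) \<in> solutions p n L"
    using assms by (auto simp: solutions_def Fp_space_def)
  then show ?thesis by blast
qed

text \<open>The character with frequencies \<open>V\<close> is trivial on the group of solutions;
  dually, for prime \<open>p\<close>, \<open>V\<close> lies coordinatewise in the row space of
  \<open>L\<close> modulo \<open>p\<close>.\<close>

definition annihilates :: "nat \<Rightarrow> nat \<Rightarrow> int mat \<Rightarrow> (nat \<Rightarrow> nat \<Rightarrow> int) \<Rightarrow> bool" where
  "annihilates p n L V \<longleftrightarrow>
     (\<forall>x\<in>solutions p n L. int p dvd (\<Sum>c<dim_col L. dot n (V c) (x c)))"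

text \<open>Orthogonality of characters: translation by a solution \<open>y\<close> with \<chi> y
  \<noteq> 1 permutes the solutions and multiplies the sum by \<chi> y, so the sum is 0.\<close>

lemma sum_add_char_solutions:
  assumes p: "p > 0"
  shows "(\<Sum>x\<in>solutions p n L. add_char p (\<Sum>c<dim_col L. dot n (V c) (x c))) =
    (if annihilates p n L V then of_nat (card (solutions p n L)) else 0)"
proof (cases "annihilates p n L V")
  case True
  then have "(\<Sum>x\<in>solutions p n L. add_char p (\<Sum>c<dim_col L. dot n (V c) (x c))) =
      (\<Sum>x\<in>solutions p n L. 1)"
    by (intro sum.cong) (auto simp: annihilates_def add_char_eq_1_iff[OF p])
  then show ?thesis using True by simp
next
  case False
  define \<chi> where "\<chi> x = add_char p (\<Sum>c<dim_col L. dot n (V c) (x c))" for x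
  obtain y where y: "y \<in> solutions p n L" and "\<chi> y \<noteq> 1"
    using False by (auto simp: annihilates_def \<chi>_def add_char_eq_1_iff[OF p])
  \<comment> \<open>Translation by \<open>y\<close>, reduced to least residues so as to stay in
    \<open>Fp_space\<close>.\<close>
  define \<tau> where "\<tau> x = (\<lambda>c\<in>{..<dim_col L}. vec n (\<lambda>j. (x c $ j + y c $ j) mod int p))" for x
  have sol: "\<tau> x \<in> solutions p n L" if x: "x \<in> solutions p n L" for x
  proof -
    have "[(\<Sum>c<dim_col L. L $$ (i, c) * \<tau> x c $ j) = 0] (mod int p)"
      if "i < dim_row L" "j < n" for i j
    proof -
      have "[(\<Sum>c<dim_col L. L $$ (i, c) * \<tau> x c $ j) =
          (\<Sum>c<dim_col L. L $$ (i, c) * (x c $ j + y c $ j))] (mod int p)"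
        using that by (intro cong_sum cong_mult cong_refl) (simp_all add: \<tau>_def cong_def)
      also have "(\<Sum>c<dim_col L. L $$ (i, c) * (x c $ j + y c $ j)) =
          (\<Sum>c<dim_col L. L $$ (i, c) * x c $ j) + (\<Sum>c<dim_col L. L $$ (i, c) * y c $ j)"
        by (simp add: algebra_simps sum.distrib)
      also have "[\<dots> = 0 + 0] (mod int p)"
        using x y that by (intro cong_add) (auto simp: solutions_def)
      finally show ?thesis by simp
    qed
    then show ?thesis
      unfolding solutions_def using p by (auto simp: \<tau>_def vec_mod_in_Fp_space)
  qed
  have "inj_on \<tau> (solutions p n L)"
  proof (rule inj_onI)
    fix x x' assume x: "x \<in> solutions p n L" "x' \<in> solutions p n L" and eq: "\<tau> x = \<tau> x'"
    show "x = x'"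
    proof (rule PiE_ext)
      show "x \<in> {..<dim_col L} \<rightarrow>\<^sub>E Fp_space p n" "x' \<in> {..<dim_col L} \<rightarrow>\<^sub>E Fp_space p n"
        using x by (auto simp: solutions_def)
    next
      fix c assume c: "c \<in> {..<dim_col L}"
      have mem: "x c \<in> Fp_space p n" "x' c \<in> Fp_space p n"
        using x c by (auto simp: solutions_def)
      show "x c = x' c"
      proof (rule eq_vecI)
        fix j assume "j < dim_vec (x' c)"
        then have j: "j < n" using mem(2) by (auto simp: Fp_space_def)
        have "\<tau> x c $ j = \<tau> x' c $ j" using eq by simp
        then have "[x c $ j + y c $ j = x' c $ j + y c $ j] (mod int p)"
          using c j by (simp add: \<tau>_def cong_def)
        then have "[x c $ j = x' c $ j] (mod int p)" by (simp add: cong_add_rcancel)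
        moreover have "x c $ j \<in> {0..<int p}" "x' c $ j \<in> {0..<int p}"
          using mem j by (auto simp: Fp_space_def)
        ultimately show "x c $ j = x' c $ j" by (simp add: cong_def)
      qed (use mem in \<open>auto simp: Fp_space_def\<close>)
    qed
  qed
  then have bij: "bij_betw \<tau> (solutions p n L) (solutions p n L)"
    using sol finite_solutions by (simp add: bij_betw_def endo_inj_surj image_subset_iff)
  have \<chi>\<tau>: "\<chi> (\<tau> x) = \<chi> x * \<chi> y" for x
  proof -
    have "[(\<Sum>c<dim_col L. dot n (V c) (\<tau> x c)) =
        (\<Sum>c<dim_col L. \<Sum>j<n. V c j * (x c $ j + y c $ j))] (mod int p)"
      unfolding dot_def by (intro cong_sum cong_mult cong_refl) (simp_all add: \<tau>_def cong_def)
    also have "(\<Sum>c<dim_col L. \<Sum>j<n. V c j * (x c $ j + y c $ j)) =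
        (\<Sum>c<dim_col L. dot n (V c) (x c)) + (\<Sum>c<dim_col L. dot n (V c) (y c))"
      by (simp add: dot_def algebra_simps sum.distrib)
    finally show ?thesis
      using add_char_mod[OF p] by (simp add: \<chi>_def add_char_add)
  qed
  have "(\<Sum>x\<in>solutions p n L. \<chi> x) = (\<Sum>x\<in>solutions p n L. \<chi> (\<tau> x))"
    using sum.reindex_bij_betw[OF bij, of \<chi>] by simp
  also have "\<dots> = (\<Sum>x\<in>solutions p n L. \<chi> x) * \<chi> y"
    by (simp add: \<chi>\<tau> sum_distrib_right)
  finally have "(\<Sum>x\<in>solutions p n L. \<chi> x) * (1 - \<chi> y) = 0" by (simp add: algebra_simps)
  then show ?thesis using False \<open>\<chi> y \<noteq> 1\<close> by (simp add: \<chi>_def)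
qed

text \<open>Expand the product over the variables, exchange the sums and apply orthogonality.
  Distinct integer frequencies in \<open>T\<close> may agree modulo \<open>p\<close> without
  harm.\<close>

lemma t_density_fourier:
  fixes F :: "(nat \<Rightarrow> int) \<Rightarrow> real"
  assumes p: "p > 0" and T: "finite T"
    and f: "\<And>x. of_real (f x) = (\<Sum>u\<in>T. of_real (F u) * add_char p (dot n u x))"
  shows "t_density p n L f =
    (\<Sum>V | V \<in> {..<dim_col L} \<rightarrow>\<^sub>E T \<and> annihilates p n L V. \<Prod>c<dim_col L. F (V c))"
proof -
  define W where "W = {..<dim_col L} \<rightarrow>\<^sub>E T"
  define N where "N = card (solutions p n L)"
  have finW: "finite W" unfolding W_def using T by (intro finite_PiE) auto
  have N: "N > 0" unfolding N_def using finite_solutions solutions_nonempty[OF p] by (simp add: card_gt_0_iff)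
  have "complex_of_real (\<Sum>x\<in>solutions p n L. \<Prod>c<dim_col L. f (x c)) =
      (\<Sum>x\<in>solutions p n L. \<Prod>c<dim_col L. \<Sum>u\<in>T. of_real (F u) * add_char p (dot n u (x c)))"
    by (simp add: f)
  also have "\<dots> = (\<Sum>x\<in>solutions p n L. \<Sum>V\<in>W. \<Prod>c<dim_col L. of_real (F (V c)) * add_char p (dot n (V c) (x c)))"
    using T by (simp add: prod_sum_PiE W_def)
  also have "\<dots> = (\<Sum>V\<in>W. \<Sum>x\<in>solutions p n L. \<Prod>c<dim_col L. of_real (F (V c)) * add_char p (dot n (V c) (x c)))"
    by (rule sum.swap)
  also have "\<dots> = (\<Sum>V\<in>W. (\<Prod>c<dim_col L. of_real (F (V c))) *
      (\<Sum>x\<in>solutions p n L. add_char p (\<Sum>c<dim_col L. dot n (V c) (x c))))"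
    by (simp add: prod.distrib add_char_sum sum_distrib_left)
  also have "\<dots> = (\<Sum>V\<in>W. if annihilates p n L V then of_real ((\<Prod>c<dim_col L. F (V c)) * N) else 0)"
    by (intro sum.cong refl) (simp add: sum_add_char_solutions[OF p] N_def)
  also have "\<dots> = (\<Sum>V | V \<in> W \<and> annihilates p n L V. of_real ((\<Prod>c<dim_col L. F (V c)) * N))"
    using finW by (simp add: sum.If_cases Int_def)
  also have "\<dots> = complex_of_real ((\<Sum>V | V \<in> W \<and> annihilates p n L V. \<Prod>c<dim_col L. F (V c)) * N)"
    by (simp add: sum_distrib_right)
  finally have "(\<Sum>x\<in>solutions p n L. \<Prod>c<dim_col L. f (x c)) =
      (\<Sum>V | V \<in> W \<and> annihilates p n L V. \<Prod>c<dim_col L. F (V c)) * N"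
    by (simp only: of_real_eq_iff)
  then show ?thesis using N by (simp add: t_density_def N_def W_def)
qed

section \<open>The row space modulo large primes\<close>

lemma prime_not_dvd_if_large:
  fixes z :: int
  assumes "z \<noteq> 0" "nat \<bar>z\<bar> < p"
  shows "\<not> int p dvd z"
  using assms zdvd_imp_le[of "int p" "\<bar>z\<bar>"] by auto

text \<open>Some multiple d_j of coordinate \<open>j\<close> of \<open>V\<close> is an integer
  combination of rows, so \<open>p\<close> divides d_j times its value at every solution modulo
  \<open>p\<close>; a prime above all |d_j| can be cancelled.\<close>

lemma eventually_annihilates_if_implied:
  assumes "\<And>j. j < n \<Longrightarrow> implied_equation L (\<lambda>c. V c j)"
  shows "\<forall>\<^sub>F p in at_top. prime p \<longrightarrow> annihilates p n L V"
proof -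
  have "\<exists>d lam. d \<noteq> 0 \<and> (\<forall>c<dim_col L. d * V c j = (\<Sum>i<dim_row L. lam i * L $$ (i, c)))"
    if "j < n" for j
    using implied_equation_combination[OF assms[OF that]] by metis
  then obtain d lam where d: "\<And>j. j < n \<Longrightarrow> d j \<noteq> 0"
    and lam: "\<And>j c. j < n \<Longrightarrow> c < dim_col L \<Longrightarrow>
      d j * V c j = (\<Sum>i<dim_row L. lam j i * L $$ (i, c))" by metis
  have "\<forall>\<^sub>F p in at_top. \<forall>j\<in>{..<n}. nat \<bar>d j\<bar> < p"
    by (intro eventually_ball_finite ballI eventually_gt_at_top) auto
  then show ?thesis
  proof eventually_elim
    case (elim p)
    show ?case
      unfolding annihilates_def
    proof (intro impI ballI)
      fix x assume "prime p" and x: "x \<in> solutions p n L"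
      have "int p dvd (\<Sum>c<dim_col L. V c j * x c $ j)" if j: "j < n" for j
      proof -
        have "d j * (\<Sum>c<dim_col L. V c j * x c $ j) =
            (\<Sum>c<dim_col L. (\<Sum>i<dim_row L. lam j i * L $$ (i, c)) * x c $ j)"
          by (simp add: lam[OF j, symmetric] sum_distrib_left mult.assoc)
        also have "\<dots> = (\<Sum>i<dim_row L. lam j i * (\<Sum>c<dim_col L. L $$ (i, c) * x c $ j))"
          unfolding sum_distrib_right sum_distrib_left by (subst sum.swap) (simp add: mult.assoc)
        also have "int p dvd \<dots>"
        proof (rule dvd_sum)
          fix i assume "i \<in> {..<dim_row L}"
          then have "int p dvd (\<Sum>c<dim_col L. L $$ (i, c) * x c $ j)"
            using x j by (simp add: solutions_def cong_0_iff)
          then show "int p dvd lam j i * (\<Sum>c<dim_col L. L $$ (i, c) * x c $ j)" by (rule dvd_mult)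
        qed
        finally have "int p dvd d j * (\<Sum>c<dim_col L. V c j * x c $ j)" .
        moreover have "\<not> int p dvd d j" using prime_not_dvd_if_large d[OF j] elim j by auto
        ultimately show ?thesis using \<open>prime p\<close> prime_dvd_mult_iff[of "int p"] by auto
      qed
      then have "int p dvd (\<Sum>j<n. \<Sum>c<dim_col L. V c j * x c $ j)"
        by (rule dvd_sum) simp
      then show "int p dvd (\<Sum>c<dim_col L. dot n (V c) (x c))"
        unfolding dot_def by (subst sum.swap)
    qed
  qed
qed

text \<open>An integer solution at which coordinate \<open>j\<close> of \<open>V\<close> has a
  nonzero value, placed in coordinate \<open>j\<close> of the space and reduced, is a witness once
  \<open>p\<close> exceeds the absolute value.\<close>

lemma eventually_not_annihilates_if_not_implied:
  assumes "j < n" "\<not> implied_equation L (\<lambda>c. V c j)"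
  shows "\<forall>\<^sub>F p in at_top. \<not> annihilates p n L V"
proof -
  obtain x where x: "\<And>i. i < dim_row L \<Longrightarrow> (\<Sum>c<dim_col L. L $$ (i, c) * x c) = 0"
    and nz: "(\<Sum>c<dim_col L. V c j * x c) \<noteq> 0"
    using assms(2) by (auto simp: implied_equation_def)
  have "\<forall>\<^sub>F p in at_top. nat \<bar>\<Sum>c<dim_col L. V c j * x c\<bar> < p" by (rule eventually_gt_at_top)
  then show ?thesis
  proof eventually_elim
    case (elim p)
    then have p: "p > 0" by simp
    define X where "X = (\<lambda>c\<in>{..<dim_col L}. vec n (\<lambda>l. (if l = j then x c else 0) mod int p))"
    have "[(\<Sum>c<dim_col L. L $$ (i, c) * X c $ l) = 0] (mod int p)" if "i < dim_row L" "l < n" for i l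
    proof -
      have "[(\<Sum>c<dim_col L. L $$ (i, c) * X c $ l) =
          (\<Sum>c<dim_col L. L $$ (i, c) * (if l = j then x c else 0))] (mod int p)"
        using that by (intro cong_sum cong_mult cong_refl) (simp_all add: X_def cong_def)
      also have "(\<Sum>c<dim_col L. L $$ (i, c) * (if l = j then x c else 0)) = 0"
        using x[OF that(1)] by (cases "l = j") auto
      finally show ?thesis .
    qed
    then have "X \<in> solutions p n L"
      unfolding solutions_def using p by (auto simp: X_def vec_mod_in_Fp_space)
    moreover have "[(\<Sum>c<dim_col L. dot n (V c) (X c)) = (\<Sum>c<dim_col L. V c j * x c)] (mod int p)"
    proof -
      have "[(\<Sum>c<dim_col L. dot n (V c) (X c)) =
          (\<Sum>c<dim_col L. \<Sum>l<n. V c l * (if l = j then x c else 0))] (mod int p)"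
        unfolding dot_def by (intro cong_sum cong_mult cong_refl) (simp_all add: X_def cong_def)
      also have "(\<Sum>c<dim_col L. \<Sum>l<n. V c l * (if l = j then x c else 0)) = (\<Sum>c<dim_col L. V c j * x c)"
        using assms(1) by (intro sum.cong refl) (simp add: if_distrib cong: if_cong)
      finally show ?thesis .
    qed
    moreover have "\<not> int p dvd (\<Sum>c<dim_col L. V c j * x c)"
      using prime_not_dvd_if_large nz elim by blast
    ultimately show ?case unfolding annihilates_def using cong_dvd_iff by blast
  qed
qed

lemma eventually_annihilates_iff:
  "\<forall>\<^sub>F p in at_top. prime p \<longrightarrow> (annihilates p n L V \<longleftrightarrow> (\<forall>j<n. implied_equation L (\<lambda>c. V c j)))"
proof (cases "\<forall>j<n. implied_equation L (\<lambda>c. V c j)")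
  case True
  then show ?thesis using eventually_annihilates_if_implied[of n L V] by simp
next
  case False
  then obtain j where "j < n" "\<not> implied_equation L (\<lambda>c. V c j)" by blast
  then have "\<forall>\<^sub>F p in at_top. \<not> annihilates p n L V"
    by (rule eventually_not_annihilates_if_not_implied)
  then show ?thesis
    by (rule eventually_mono) (use False in auto)
qed

section \<open>Perturbing the constant function one half\<close>

lemma prod_freq_coefficients:
  fixes g :: "'a \<Rightarrow> real"
  shows "(\<Prod>c<K. if V c = z then 1 / 2 else \<delta> * g (V c)) =
    (1 / 2) ^ (K - card {c. c < K \<and> V c \<noteq> z}) * \<delta> ^ card {c. c < K \<and> V c \<noteq> z} *
    (\<Prod>c | c < K \<and> V c \<noteq> z. g (V c))"
proof -
  define S where "S = {c. c < K \<and> V c \<noteq> z}"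
  have S: "S \<subseteq> {..<K}" "finite S" by (auto simp: S_def)
  have "(\<Prod>c<K. if V c = z then 1 / 2 else \<delta> * g (V c)) =
      (\<Prod>c\<in>{..<K} - S. if V c = z then 1 / 2 else \<delta> * g (V c)) *
      (\<Prod>c\<in>S. if V c = z then 1 / 2 else \<delta> * g (V c))"
    using S by (intro prod.subset_diff) auto
  also have "(\<Prod>c\<in>{..<K} - S. if V c = z then 1 / 2 else \<delta> * g (V c)) = (\<Prod>c\<in>{..<K} - S. 1 / 2)"
    by (intro prod.cong) (auto simp: S_def)
  also have "\<dots> = (1 / 2) ^ (K - card S)" using S by (simp add: card_Diff_subset)
  also have "(\<Prod>c\<in>S. if V c = z then 1 / 2 else \<delta> * g (V c)) = (\<Prod>c\<in>S. \<delta> * g (V c))"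
    by (intro prod.cong) (auto simp: S_def)
  also have "\<dots> = \<delta> ^ card S * (\<Prod>c\<in>S. g (V c))" by (simp add: prod.distrib)
  finally show ?thesis by (simp add: S_def mult.assoc)
qed

text \<open>Symmetry of \<open>T\<close> and evenness of \<open>g\<close> cancel the imaginary
  parts. This makes the perturbation real while keeping its character expansion.\<close>

lemma sum_cos_eq_sum_add_char:
  fixes g :: "(nat \<Rightarrow> int) \<Rightarrow> real"
  assumes g: "\<And>u. g (\<lambda>j. - u j) = g u" and T: "\<And>u. u \<in> T \<Longrightarrow> (\<lambda>j. - u j) \<in> T"
  shows "of_real (\<Sum>u\<in>T. g u * cos (2 * pi * of_int (dot n u x) / of_nat p)) =
    (\<Sum>u\<in>T. of_real (g u) * add_char p (dot n u x))"
proof -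
  define \<theta> where "\<theta> u = 2 * pi * real_of_int (dot n u x) / of_nat p" for u
  have \<theta>: "\<theta> (\<lambda>j. - u j) = - \<theta> u" for u
    by (simp add: \<theta>_def dot_def sum_negf)
  have "bij_betw (\<lambda>u j. - u j) T T"
    by (rule bij_betwI[where g = "\<lambda>u j. - u j"]) (use T in auto)
  then have "(\<Sum>u\<in>T. of_real (g u) * cis (\<theta> u)) = (\<Sum>u\<in>T. of_real (g (\<lambda>j. - u j)) * cis (\<theta> (\<lambda>j. - u j)))"
    by (rule sum.reindex_bij_betw[symmetric])
  also have "\<dots> = (\<Sum>u\<in>T. of_real (g u) * cis (- \<theta> u))" by (simp add: g \<theta>)
  finally have "2 * (\<Sum>u\<in>T. of_real (g u) * cis (\<theta> u)) =
      (\<Sum>u\<in>T. of_real (g u) * (cis (\<theta> u) + cis (- \<theta> u)))"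
    by (simp add: distrib_left sum.distrib)
  also have "\<dots> = (\<Sum>u\<in>T. 2 * of_real (g u * cos (\<theta> u)))"
    by (intro sum.cong refl) (simp add: complex_eq_iff)
  also have "\<dots> = 2 * of_real (\<Sum>u\<in>T. g u * cos (\<theta> u))"
    by (simp add: sum_distrib_left)
  finally show ?thesis by (simp add: \<theta>_def add_char_def)
qed

text \<open>Order the terms by the size of their support: 0 gives 2^(1-K), the odd size k - 1
  cancels, size \<open>k\<close> is negative of order \<epsilon>^k by \<open>neg\<close>, and the
  finitely many others are O(\<epsilon>^(k+1)).\<close>

lemma uncommon_if_negative_frequencies:
  fixes g :: "(nat \<Rightarrow> int) \<Rightarrow> int"
  assumes T: "finite T" "\<And>u. u \<in> T \<Longrightarrow> (\<lambda>j. - u j) \<in> T" "\<And>u. u \<in> T \<Longrightarrow> \<exists>j<n. u j \<noteq> 0"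
    and g: "\<And>u. \<bar>g u\<bar> = 1" "\<And>u. g (\<lambda>j. - u j) = g u"
    and k: "even k" "k > 0" and girth: "girth L = k - 1"
    and W: "W = {V \<in> {..<dim_col L} \<rightarrow>\<^sub>E insert (\<lambda>_. 0) T. (\<forall>j<n. implied_equation L (\<lambda>c. V c j)) \<and>
      card {c. c < dim_col L \<and> V c \<noteq> (\<lambda>_. 0)} = k}"
    and neg: "(\<Sum>V\<in>W. \<Prod>c | c < dim_col L \<and> V c \<noteq> (\<lambda>_. 0). g (V c)) < 0"
  shows "\<exists>p0. \<forall>p. prime p \<and> p \<ge> p0 \<longrightarrow> uncommon_over p L"
proof -
  define K where "K = dim_col L"
  define z :: "nat \<Rightarrow> int" where "z = (\<lambda>_. 0)"
  define E where "E = {..<K} \<rightarrow>\<^sub>E insert z T"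
  define Z where "Z = {V \<in> E. \<forall>j<n. implied_equation L (\<lambda>c. V c j)}"
  define s where "s V = card {c. c < K \<and> V c \<noteq> z}" for V :: "nat \<Rightarrow> nat \<Rightarrow> int"
  define P where "P V = (\<Prod>c | c < K \<and> V c \<noteq> z. real_of_int (g (V c)))" for V :: "nat \<Rightarrow> nat \<Rightarrow> int"
  define V0 where "V0 = (\<lambda>c\<in>{..<K}. z)"
  have zT: "z \<notin> T" using T(3) by (auto simp: z_def)
  have finE: "finite E" unfolding E_def using T(1) by (intro finite_PiE) auto
  then have finZ: "finite Z" by (simp add: Z_def)
  have W': "W = {V \<in> Z. s V = k}" by (auto simp: W Z_def E_def s_def K_def z_def)
  have finW: "finite W" using finZ W' by simp
  have V0: "V0 \<in> Z" by (auto simp: Z_def E_def V0_def K_def z_def implied_equation_def)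
  have sV0: "s V0 = 0" by (simp add: s_def V0_def)
  have PV0: "P V0 = 1" by (auto simp: P_def V0_def intro!: prod.neutral)
  have absP: "\<bar>P V\<bar> = 1" for V
  proof -
    have "\<bar>real_of_int (g u)\<bar> = 1" for u using g(1)[of u] by linarith
    then show ?thesis by (simp add: P_def abs_prod)
  qed
  \<comment> \<open>The sum is an integer, so being negative means at most -1.\<close>
  have sum_P: "(\<Sum>V\<in>W. P V) \<le> -1"
  proof -
    have "(\<Sum>V\<in>W. P V) = real_of_int (\<Sum>V\<in>W. \<Prod>c | c < dim_col L \<and> V c \<noteq> (\<lambda>_. 0). g (V c))"
      by (simp add: P_def K_def z_def)
    then show ?thesis using neg by linarith
  qed
  \<comment> \<open>A nonzero tuple has a nonzero coordinate vector, which is an implied equation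
    supported inside the support of the tuple.\<close>
  have s_ge: "k - 1 \<le> s V" if V: "V \<in> Z" "V \<noteq> V0" for V
  proof -
    have "\<exists>c<K. V c \<noteq> z"
    proof (rule ccontr)
      assume "\<not> ?thesis"
      then have "V = V0"
        using V(1) by (intro PiE_ext[of V "{..<K}" "\<lambda>_. insert z T"]) (auto simp: Z_def E_def V0_def)
      then show False using V(2) by simp
    qed
    then obtain c where c: "c < K" "V c \<noteq> z" by blast
    then have "V c \<in> T" using V(1) by (auto simp: Z_def E_def)
    then obtain j where j: "j < n" "V c j \<noteq> 0" using T(3) by blast
    have "girth L \<le> card {c. c < dim_col L \<and> V c j \<noteq> 0}"
      by (rule girth_le_implied_equation) (use V(1) c j in \<open>auto simp: Z_def K_def\<close>)
    also have "\<dots> \<le> s V"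
      unfolding s_def by (intro card_mono) (auto simp: K_def z_def)
    finally show ?thesis by (simp add: girth)
  qed
  define N where "N = real (card Z)"
  \<comment> \<open>One choice serves three needs: \<epsilon> \<le> 1; \<epsilon> |T| \<le> 1/2,
    which keeps the values in [0, 1]; and \<epsilon> N < (1/2)^K, which keeps the \<open>N\<close>
    error terms below the gain.\<close>
  define \<epsilon> where "\<epsilon> = (1 / 2) ^ K / (2 * (N + card T + 1))"
  have N: "N \<ge> 0" by (simp add: N_def)
  have \<epsilon>0: "\<epsilon> > 0" using N by (auto simp: \<epsilon>_def intro!: divide_pos_pos add_nonneg_pos)
  have half: "(1 / 2 :: real) ^ K \<le> 1" by (simp add: power_le_one)
  have \<epsilon>_eq: "\<epsilon> * (2 * (N + card T + 1)) = (1 / 2) ^ K"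
    using N by (simp add: \<epsilon>_def add_nonneg_pos less_imp_neq[symmetric])
  then have eq': "2 * (\<epsilon> * N) + 2 * (\<epsilon> * card T) + 2 * \<epsilon> = (1 / 2) ^ K"
    by (simp add: algebra_simps)
  have nn: "\<epsilon> * N \<ge> 0" "\<epsilon> * card T \<ge> 0" using N \<epsilon>0 by simp_all
  have \<epsilon>1: "\<epsilon> \<le> 1" and \<epsilon>T: "\<epsilon> * card T \<le> 1 / 2" and \<epsilon>N: "\<epsilon> * N < (1 / 2) ^ K"
    using eq' nn half \<epsilon>0 by linarith+
  \<comment> \<open>Joint contribution of \<open>V\<close> to both densities: the power of
    \<epsilon> comes from f, that of - \<epsilon> from 1 - f.\<close>
  define h where "h V = (1 / 2) ^ (K - s V) * (\<epsilon> ^ s V + (- \<epsilon>) ^ s V) * P V" for V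
  \<comment> \<open>The summands account for the zero tuple, for support \<open>k\<close>, and, as
    slack granted to every tuple, for larger supports.\<close>
  have h_le: "h V \<le> (if V = V0 then 2 * (1 / 2) ^ K else 0) +
      (if s V = k then 2 * (1 / 2) ^ (K - k) * \<epsilon> ^ k * P V else 0) + 2 * \<epsilon> ^ (k + 1)"
    if V: "V \<in> Z" for V
  proof -
    consider "V = V0" | "V \<noteq> V0" "s V = k" | "V \<noteq> V0" "s V = k - 1" | "V \<noteq> V0" "s V \<ge> k + 1"
      using s_ge[OF V] by linarith
    then show ?thesis
    proof cases
      case 1
      then show ?thesis using sV0 PV0 k \<epsilon>0 by (simp add: h_def)
    next
      case 2
      then show ?thesis using k \<epsilon>0 by (simp add: h_def)
    next
      case 3
      have "odd (k - 1)" "k - 1 \<noteq> k" using k by auto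
      then show ?thesis using 3 \<epsilon>0 by (simp add: h_def)
    next
      case 4
      have "\<bar>\<epsilon> ^ s V + (- \<epsilon>) ^ s V\<bar> \<le> \<bar>\<epsilon> ^ s V\<bar> + \<bar>(- \<epsilon>) ^ s V\<bar>" by (rule abs_triangle_ineq)
      also have "\<dots> = 2 * \<epsilon> ^ s V" using \<epsilon>0 by (simp add: power_abs)
      finally have *: "\<bar>\<epsilon> ^ s V + (- \<epsilon>) ^ s V\<bar> \<le> 2 * \<epsilon> ^ s V" .
      have "h V \<le> \<bar>h V\<bar>" by simp
      also have "\<bar>h V\<bar> = (1 / 2) ^ (K - s V) * \<bar>\<epsilon> ^ s V + (- \<epsilon>) ^ s V\<bar>"
        by (simp add: h_def abs_mult absP)
      also have "\<dots> \<le> 1 * (2 * \<epsilon> ^ s V)"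
        using * by (intro mult_mono) (auto simp: power_le_one)
      also have "1 * (2 * \<epsilon> ^ s V) \<le> 2 * \<epsilon> ^ (k + 1)"
        unfolding mult_1
        by (rule mult_left_mono, rule power_decreasing) (use 4 \<epsilon>0 \<epsilon>1 in simp_all)
      finally show ?thesis using 4 by simp
    qed
  qed
  have "(\<Sum>V\<in>Z. h V) \<le> (\<Sum>V\<in>Z. (if V = V0 then 2 * (1 / 2) ^ K else 0) +
      (if s V = k then 2 * (1 / 2) ^ (K - k) * \<epsilon> ^ k * P V else 0) + 2 * \<epsilon> ^ (k + 1))"
    by (intro sum_mono h_le)
  also have "\<dots> = 2 * (1 / 2) ^ K + 2 * (1 / 2) ^ (K - k) * \<epsilon> ^ k * (\<Sum>V\<in>W. P V) + N * (2 * \<epsilon> ^ (k + 1))"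
    using V0 finZ by (simp add: sum.distrib W' N_def sum_distrib_left flip: sum.inter_filter)
  also have "2 * (1 / 2) ^ (K - k) * \<epsilon> ^ k * (\<Sum>V\<in>W. P V) \<le> 2 * (1 / 2) ^ (K - k) * \<epsilon> ^ k * (-1)"
    using sum_P \<epsilon>0 by (intro mult_left_mono) auto
  \<comment> \<open>Part of the gain is given away here to match the power (1/2)^K in the choice of
    \<epsilon>.\<close>
  also have "\<dots> \<le> 2 * (1 / 2) ^ K * \<epsilon> ^ k * (-1)"
  proof -
    have "(1 / 2 :: real) ^ K \<le> (1 / 2) ^ (K - k)" by (intro power_decreasing) auto
    then show ?thesis using \<epsilon>0 by (simp add: mult_right_mono)
  qed
  also have "2 * (1 / 2) ^ K + 2 * (1 / 2) ^ K * \<epsilon> ^ k * (-1) + N * (2 * \<epsilon> ^ (k + 1)) =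
      2 * (1 / 2) ^ K + 2 * \<epsilon> ^ k * (\<epsilon> * N - (1 / 2) ^ K)"
    by (simp add: algebra_simps)
  also have "\<dots> < 2 * (1 / 2) ^ K"
    using \<epsilon>0 \<epsilon>N by (simp add: mult_pos_neg)
  also have "\<dots> = 2 powi (1 - int K)"
    by (simp add: power_int_diff power_divide)
  finally have total: "(\<Sum>V\<in>Z. h V) < 2 powi (1 - int K)" by simp
  \<comment> \<open>The threshold for \<open>p\<close> depends on the tuple; finiteness of
    \<open>E\<close> provides a common one.\<close>
  have "\<forall>\<^sub>F p in at_top. \<forall>V\<in>E. prime p \<longrightarrow>
      (annihilates p n L V \<longleftrightarrow> (\<forall>j<n. implied_equation L (\<lambda>c. V c j)))"
    by (intro eventually_ball_finite finE ballI eventually_annihilates_iff)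
  then obtain p0 where p0: "\<And>p V. p \<ge> p0 \<Longrightarrow> V \<in> E \<Longrightarrow> prime p \<Longrightarrow>
      annihilates p n L V \<longleftrightarrow> (\<forall>j<n. implied_equation L (\<lambda>c. V c j))"
    by (auto simp: eventually_sequentially)
  have "uncommon_over p L" if p: "prime p" "p \<ge> p0" for p
  proof
    assume common: "common_over p L"
    have pos: "p > 0" using p prime_gt_0_nat by blast
    define q where "q x = (\<Sum>u\<in>T. real_of_int (g u) * cos (2 * pi * of_int (dot n u x) / of_nat p))" for x
    \<comment> \<open>Fourier coefficients of 1/2 + \<delta> q, used with \<delta> = \<epsilon> for
      f and \<delta> = - \<epsilon> for 1 - f.\<close>
    define F where "F \<delta> u = (if u = z then 1 / 2 else \<delta> * real_of_int (g u))" for \<delta> u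
    have fourier: "of_real (1 / 2 + \<delta> * q x) = (\<Sum>u\<in>insert z T. of_real (F \<delta> u) * add_char p (dot n u x))"
      for \<delta> x
    proof -
      have "(\<Sum>u\<in>T. of_real (F \<delta> u) * add_char p (dot n u x)) =
          of_real \<delta> * (\<Sum>u\<in>T. of_real (real_of_int (g u)) * add_char p (dot n u x))"
        unfolding sum_distrib_left by (intro sum.cong) (use zT in \<open>auto simp: F_def\<close>)
      also have "\<dots> = of_real (\<delta> * q x)"
        unfolding q_def of_real_mult
        by (subst sum_cos_eq_sum_add_char) (use T g in auto)
      finally have "(\<Sum>u\<in>T. of_real (F \<delta> u) * add_char p (dot n u x)) = of_real (\<delta> * q x)" .
      moreover have "add_char p (dot n z x) = 1" by (simp add: dot_def z_def add_char_def)
      ultimately show ?thesis using T(1) zT by (simp add: F_def)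
    qed
    have density: "t_density p n L (\<lambda>x. 1 / 2 + \<delta> * q x) = (\<Sum>V\<in>Z. (1 / 2) ^ (K - s V) * \<delta> ^ s V * P V)"
      for \<delta>
    proof -
      have "t_density p n L (\<lambda>x. 1 / 2 + \<delta> * q x) =
          (\<Sum>V | V \<in> E \<and> annihilates p n L V. \<Prod>c<K. F \<delta> (V c))"
        unfolding E_def K_def by (rule t_density_fourier[OF pos _ fourier]) (use T in simp)
      also have "{V. V \<in> E \<and> annihilates p n L V} = Z"
        using p0 p by (auto simp: Z_def)
      finally show ?thesis
        unfolding F_def s_def P_def
        by (simp only: prod_freq_coefficients[where g = "\<lambda>u. real_of_int (g u)"])
    qed
    have q: "\<bar>q x\<bar> \<le> card T" for x
    proof -
      have "\<bar>q x\<bar> \<le> (\<Sum>u\<in>T. \<bar>real_of_int (g u) * cos (2 * pi * of_int (dot n u x) / of_nat p)\<bar>)"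
        unfolding q_def by (rule sum_abs)
      also have "\<dots> \<le> (\<Sum>u\<in>T. 1)"
      proof (rule sum_mono)
        fix u
        have "\<bar>real_of_int (g u)\<bar> = 1" using g(1)[of u] by linarith
        then show "\<bar>real_of_int (g u) * cos (2 * pi * of_int (dot n u x) / of_nat p)\<bar> \<le> 1"
          by (simp add: abs_mult)
      qed
      finally show ?thesis by simp
    qed
    have range: "1 / 2 + \<epsilon> * q x \<in> {0..1}" for x
    proof -
      have "\<bar>\<epsilon> * q x\<bar> \<le> \<epsilon> * card T"
        using q[of x] \<epsilon>0 by (simp add: abs_mult)
      then show ?thesis using \<epsilon>T by (auto simp: abs_le_iff)
    qed
    have "2 powi (1 - int K) \<le> t_density p n L (\<lambda>x. 1 / 2 + \<epsilon> * q x) +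
        t_density p n L (\<lambda>x. 1 - (1 / 2 + \<epsilon> * q x))"
      using spec[OF spec[OF common[unfolded common_over_def], of n], of "\<lambda>x. 1 / 2 + \<epsilon> * q x"] range
      unfolding K_def by blast
    also have "(\<lambda>x. 1 - (1 / 2 + \<epsilon> * q x)) = (\<lambda>x. 1 / 2 + (- \<epsilon>) * q x)" by auto
    also have "t_density p n L (\<lambda>x. 1 / 2 + \<epsilon> * q x) + t_density p n L (\<lambda>x. 1 / 2 + (- \<epsilon>) * q x) =
        (\<Sum>V\<in>Z. h V)"
      by (simp only: density h_def distrib_left distrib_right sum.distrib)
    finally show False using total by simp
  qed
  then show ?thesis by blast
qed

section \<open>Uncommonness\<close>

lemma girth_module_implied_equation:
  assumes "girth L = k - 1" "k \<ge> 4"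
  shows "girth_module (implied_equation L) (dim_col L) k"
proof
  fix v w :: "nat \<Rightarrow> int" and s :: int and c :: nat
  show "implied_equation L (\<lambda>c. s * v c + t * w c)" if "implied_equation L v" "implied_equation L w" for t
    using that by (rule implied_equation_lincomb)
  show "implied_equation L v" if "implied_equation L (\<lambda>c. s * v c)" "s \<noteq> 0"
    using that by (auto simp: implied_equation_def mult.assoc simp flip: sum_distrib_left)
  show "implied_equation L w" if "implied_equation L v" "\<And>c. c < dim_col L \<Longrightarrow> v c = w c"
  proof -
    have "(\<Sum>c<dim_col L. v c * x c) = (\<Sum>c<dim_col L. w c * x c)" for x :: "nat \<Rightarrow> int"
      by (rule sum.cong) (simp_all add: that(2))
    then show ?thesis using that(1) unfolding implied_equation_def by metis
  qed
  show "v c = 0" if "implied_equation L v" "card {c. c < dim_col L \<and> v c \<noteq> 0} < k - 1" "c < dim_col L"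
    by (rule implied_equation_eq_0[OF that(1) _ that(3)]) (unfold assms(1), rule that(2))
qed (rule assms(2))

theorem theorem1p9:
  fixes k :: nat and L :: "int mat"
  assumes "k \<ge> 4" and "even k"
    and "irredundant L"
    and "girth L = k - 1"
    and "\<exists>L' \<in> carrier_mat 2 k. irredundant L' \<and> subsystem L' L"
  shows "\<exists>p\<^sub>L. \<forall>p. prime p \<and> p \<ge> p\<^sub>L \<longrightarrow> uncommon_over p L"
proof -
  obtain L' where L': "L' \<in> carrier_mat 2 k" "irredundant L'" "subsystem L' L"
    using assms(5) by blast
  have dim: "dim_row L' = 2" "dim_col L' = k" using L' by auto
  obtain \<iota> where inj: "inj_on \<iota> {..<k}" and range: "\<iota> ` {..<k} \<subseteq> {..<dim_col L}"
    and sub: "\<And>x. x \<in> carrier_vec (dim_col L) \<Longrightarrow> rat_mat L *\<^sub>v x = 0\<^sub>v (dim_row L) \<Longrightarrow>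
          rat_mat L' *\<^sub>v vec k (\<lambda>j. x $ \<iota> j) = 0\<^sub>v 2"
    using L'(3) unfolding subsystem_def dim by blast
  \<comment> \<open>Row \<open>i\<close> of \<open>L'\<close>, moved to the selected variables of
    \<open>L\<close> and extended by zero.\<close>
  define r where "r i c = (if c \<in> \<iota> ` {..<k} then L' $$ (i, inv_into {..<k} \<iota> c) else 0)" for i c
  have r: "r i (\<iota> j) = L' $$ (i, j)" if "j < k" for i j
    using that inj by (simp add: r_def)
  have implied: "implied_equation L (r i)" if "i < 2" for i
    by (rule subsystem_implied_equation[of \<iota> L' L i])
       (use inj range sub that r in \<open>auto simp: dim r_def\<close>)
  interpret girth_module "implied_equation L" "dim_col L" k
    by (rule girth_module_implied_equation) (use assms in auto)
  interpret girth_module_pair "implied_equation L" "dim_col L" k "r 0" "r 1" "\<iota> ` {..<k}"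
  proof
    show "card (\<iota> ` {..<k}) = k" using inj by (simp add: card_image)
    show "s = 0 \<and> t = 0" if "\<And>c. c < dim_col L \<Longrightarrow> s * r 0 c + t * r 1 c = 0" for s t
    proof (rule rows_independent_2[OF L'(1)])
      show "rows_independent L'" using L'(2) by (simp add: irredundant_def)
      show "s * L' $$ (0, j) + t * L' $$ (1, j) = 0" if "j < k" for j
        using \<open>\<And>c. c < dim_col L \<Longrightarrow> s * r 0 c + t * r 1 c = 0\<close>[of "\<iota> j"] range that r[OF that] by auto
    qed
  qed (use range implied in \<open>auto simp: r_def\<close>)
  obtain T and g :: "(nat \<Rightarrow> int) \<Rightarrow> int" where "finite T" "\<And>u. \<bar>g u\<bar> = 1" "\<And>u. g (\<lambda>j. - u j) = g u"
    "\<And>u. u \<in> T \<Longrightarrow> (\<lambda>j. - u j) \<in> T" "\<And>u. u \<in> T \<Longrightarrow> \<exists>j<9. u j \<noteq> 0"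
    "(\<Sum>V\<in>admissible 9 T. \<Prod>c | c < dim_col L \<and> V c \<noteq> (\<lambda>_. 0). g (V c)) < 0"
    using exists_negative_frequencies by blast
  then show ?thesis
    using assms by (intro uncommon_if_negative_frequencies[of T 9 g k L "admissible 9 T"])
      (auto simp: admissible_def)
qed

end
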